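(* Let $\tau\ge 0$ and let $\operatorname{Nil}_3=(\mathbb R^3,\mathrm ds^2)$ with $\mathrm ds^2=\mathrm dx^2+\mathrm dy^2+(2\tau x\,\mathrm dy-\mathrm dz)^2$ be Heisenberg space. Let $S$ be a properly immersed (connected, boundaryless) minimal surface in $\operatorname{Nil}_3$, and let $P\subset\operatorname{Nil}_3$ be a vertical plane. If $S$ lies to one side of $P$, then $S$ is a vertical plane parallel to $P$.
   Context: The projection $\pi\colon\operatorname{Nil}_3\to\mathbb R^2$, $\pi(x,y,z)=(x,y)$, is a Riemannian fibration onto the Euclidean plane with bundle curvature $\tau$ (for $\tau=0$ one recovers Euclidean $\mathbb R^3$). A vertical plane is a set $\pi^{-1}(\ell)$ where $\ell\subset\mathbb R^2$ is a straight line. Two vertical planes $\pi^{-1}(\ell)$ and $\pi^{-1}(\ell')$ are parallel if the lines $\ell$ and $\ell'$ are parallel (coinciding lines being allowed). A surface lies to one side of $P=\pi^{-1}(\ell)$ if it is contained in the closed half-space $\pi^{-1}(\overline{U})$, where $U$ is one of the two connected components of $\mathbb R^2\setminus\ell$. Minimal means that the mean curvature with respect to $\mathrm ds^2$ vanishes identically; properly immersed means that the immersion is a proper map into $\operatorname{Nil}_3$. *)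

theory Defs
  imports "HOL-Analysis.Analysis"
begin

section \<open>Smooth maps between Euclidean spaces\<close>

text \<open>Both notions are meant for open \<open>S\<close> only, since they use unrestricted derivatives at the
  points of \<open>S\<close>.\<close>

primrec Ck_on ::
  "nat \<Rightarrow> 'a::euclidean_space set \<Rightarrow> ('a \<Rightarrow> 'b::real_normed_vector) \<Rightarrow> bool" where
  "Ck_on 0 S f \<longleftrightarrow> continuous_on S f"
| "Ck_on (Suc k) S f \<longleftrightarrow>
     (\<forall>x\<in>S. f differentiable (at x)) \<and>
     (\<forall>v. Ck_on k S (\<lambda>x. frechet_derivative f (at x) v))"

definition smooth_on :: "'a::euclidean_space set \<Rightarrow> ('a \<Rightarrow> 'b::real_normed_vector) \<Rightarrow> bool" where
  "smooth_on S f \<longleftrightarrow> (\<forall>k. Ck_on k S f)"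

section \<open>Surfaces and immersions\<close>

type_synonym 'a chart = "'a set \<times> ('a \<Rightarrow> real ^ 2)"

text \<open>Connected 2-manifolds without boundary (nonempty, Hausdorff, second countable), with a smooth
  atlas that need not be maximal. The inverse of a chart \<open>(U, \<phi>)\<close> on \<open>\<phi> ` U\<close> is
  \<open>inv_into U \<phi>\<close>.\<close>

definition smooth_surface :: "'a topology \<Rightarrow> 'a chart set \<Rightarrow> bool" where
  "smooth_surface M A \<longleftrightarrow>
     topspace M \<noteq> {} \<and> connected_space M \<and> Hausdorff_space M \<and> second_countable M \<and>
     topspace M = (\<Union>(U, \<phi>)\<in>A. U) \<and>
     (\<forall>(U, \<phi>)\<in>A. openin M U \<and> open (\<phi> ` U) \<and>
        homeomorphic_map (subtopology M U) (top_of_set (\<phi> ` U)) \<phi>) \<and>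
     (\<forall>(U, \<phi>)\<in>A. \<forall>(V, \<psi>)\<in>A. smooth_on (\<phi> ` (U \<inter> V)) (\<psi> \<circ> inv_into U \<phi>))"

definition smooth_immersion :: "'a chart set \<Rightarrow> ('a \<Rightarrow> real ^ 3) \<Rightarrow> bool" where
  "smooth_immersion A f \<longleftrightarrow>
     (\<forall>(U, \<phi>)\<in>A. smooth_on (\<phi> ` U) (f \<circ> inv_into U \<phi>) \<and>
        (\<forall>u\<in>\<phi> ` U. inj (frechet_derivative (f \<circ> inv_into U \<phi>) (at u))))"

section \<open>Riemannian metrics on coordinate space and mean curvature\<close>

text \<open>\<open>g p v w\<close> is the inner product of the tangent vectors \<open>v\<close>, \<open>w\<close> at \<open>p\<close>, in the standard
  coordinate frame.\<close>

type_synonym 'n riem_metric = "real ^ 'n \<Rightarrow> real ^ 'n \<Rightarrow> real ^ 'n \<Rightarrow> real"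

definition partial_deriv ::
  "'n::finite \<Rightarrow> (real ^ 'n \<Rightarrow> 'b::real_normed_vector) \<Rightarrow> real ^ 'n \<Rightarrow> 'b" where
  "partial_deriv i F x = frechet_derivative F (at x) (axis i 1)"

definition metric_matrix :: "'n::finite riem_metric \<Rightarrow> real ^ 'n \<Rightarrow> real ^ 'n ^ 'n" where
  "metric_matrix g p = (\<chi> i j. g p (axis i 1) (axis j 1))"

text \<open>The Christoffel symbol of the second kind with upper index \<open>k\<close>.\<close>

definition christoffel :: "'n::finite riem_metric \<Rightarrow> 'n \<Rightarrow> 'n \<Rightarrow> 'n \<Rightarrow> real ^ 'n \<Rightarrow> real" where
  "christoffel g k i j p =
     (\<Sum>l\<in>UNIV. matrix_inv (metric_matrix g p) $ k $ l *
        (partial_deriv i (\<lambda>q. metric_matrix g q $ j $ l) p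
         + partial_deriv j (\<lambda>q. metric_matrix g q $ i $ l) p
         - partial_deriv l (\<lambda>q. metric_matrix g q $ i $ j) p)) / 2"

text \<open>For a parametrization \<open>X\<close>, the Levi-Civita covariant derivative along \<open>X\<close> of the \<open>j\<close>-th
  coordinate field in the direction of the \<open>i\<close>-th one.\<close>

definition cov_deriv ::
  "'n::finite riem_metric \<Rightarrow> (real ^ 'm::finite \<Rightarrow> real ^ 'n) \<Rightarrow> 'm \<Rightarrow> 'm \<Rightarrow> real ^ 'm \<Rightarrow> real ^ 'n" where
  "cov_deriv g X i j u =
     (\<chi> k. partial_deriv i (partial_deriv j X) u $ k +
        (\<Sum>a\<in>UNIV. \<Sum>b\<in>UNIV. christoffel g k a b (X u) *
           (partial_deriv i X u $ a) * (partial_deriv j X u $ b)))"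

definition first_fundamental_form ::
  "'n::finite riem_metric \<Rightarrow> (real ^ 'm::finite \<Rightarrow> real ^ 'n) \<Rightarrow> real ^ 'm \<Rightarrow> real ^ 'm ^ 'm" where
  "first_fundamental_form g X u = (\<chi> i j. g (X u) (partial_deriv i X u) (partial_deriv j X u))"

definition unit_normal ::
  "'n::finite riem_metric \<Rightarrow> (real ^ 'm::finite \<Rightarrow> real ^ 'n) \<Rightarrow> real ^ 'm \<Rightarrow> real ^ 'n \<Rightarrow> bool" where
  "unit_normal g X u n \<longleftrightarrow> g (X u) n n = 1 \<and> (\<forall>i. g (X u) n (partial_deriv i X u) = 0)"

definition second_fundamental_form ::
  "'n::finite riem_metric \<Rightarrow> (real ^ 'm::finite \<Rightarrow> real ^ 'n) \<Rightarrow> real ^ 'm \<Rightarrow> real ^ 'n \<Rightarrow> real ^ 'm ^ 'm"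
  where
  "second_fundamental_form g X u n = (\<chi> i j. g (X u) (cov_deriv g X i j u) n)"

definition mean_curvature ::
  "3 riem_metric \<Rightarrow> (real ^ 2 \<Rightarrow> real ^ 3) \<Rightarrow> real ^ 2 \<Rightarrow> real ^ 3 \<Rightarrow> real" where
  "mean_curvature g X u n =
     trace (matrix_inv (first_fundamental_form g X u) ** second_fundamental_form g X u n) / 2"

text \<open>At each point there are exactly two unit normals; they give opposite mean curvatures, so
  no orientation is needed.\<close>

definition minimal_immersion :: "3 riem_metric \<Rightarrow> 'a chart set \<Rightarrow> ('a \<Rightarrow> real ^ 3) \<Rightarrow> bool" where
  "minimal_immersion g A f \<longleftrightarrow>
     (\<forall>(U, \<phi>)\<in>A. \<forall>u\<in>\<phi> ` U. \<forall>n. unit_normal g (f \<circ> inv_into U \<phi>) u n \<longrightarrow>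
        mean_curvature g (f \<circ> inv_into U \<phi>) u n = 0)"

section \<open>Heisenberg space and its vertical planes\<close>

text \<open>The polarization of \<open>dx\<^sup>2 + dy\<^sup>2 + (2 \<tau> x dy - dz)\<^sup>2\<close>.\<close>

definition nil_metric :: "real \<Rightarrow> 3 riem_metric" where
  "nil_metric \<tau> p v w =
     v $ 1 * w $ 1 + v $ 2 * w $ 2 +
     (2 * \<tau> * p $ 1 * v $ 2 - v $ 3) * (2 * \<tau> * p $ 1 * w $ 2 - w $ 3)"

definition nil_proj :: "real ^ 3 \<Rightarrow> real ^ 2" where
  "nil_proj p = vector [p $ 1, p $ 2]"

definition straight_line :: "(real ^ 2) set \<Rightarrow> bool" where
  "straight_line l \<longleftrightarrow> affine l \<and> aff_dim l = 1"

definition vertical_plane :: "(real ^ 3) set \<Rightarrow> bool" where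
  "vertical_plane P \<longleftrightarrow> (\<exists>l. straight_line l \<and> P = nil_proj -` l)"

definition parallel_vertical_planes :: "(real ^ 3) set \<Rightarrow> (real ^ 3) set \<Rightarrow> bool" where
  "parallel_vertical_planes P Q \<longleftrightarrow>
     (\<exists>l l'. straight_line l \<and> straight_line l' \<and> P = nil_proj -` l \<and> Q = nil_proj -` l' \<and>
        affine_parallel l l')"

definition lies_to_one_side :: "(real ^ 3) set \<Rightarrow> (real ^ 3) set \<Rightarrow> bool" where
  "lies_to_one_side S P \<longleftrightarrow>
     (\<exists>l. straight_line l \<and> P = nil_proj -` l \<and>
        (\<exists>U\<in>components (- l). S \<subseteq> nil_proj -` closure U))"

end

(* For a unit vector (a, b) put h = a x + b y, so the plane is h = const, and let k and w be Euclidean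
   coordinates on the planes h = const. On a minimal surface the Laplacian of h is bounded by
   tau |grad h|^2, so phi(h) = h - (tau + 1) h^2 / 2 satisfies Laplace phi(h) <= - |grad h|^2 as long as
   h is small. This term absorbs the error terms that arise when the strictly
   superharmonic function G = ln (c + ln ((k - k0)^2 + (w - w0)^2)) of the planes is restricted to a
   surface that is only nearly tangent to them: its gradient satisfies |grad G|^2 <= C |Laplace G|,
   which is what the double logarithm is chosen for. So for small eta the function phi(h) + eta G has
   no local minimum on a minimal surface.

   Since G tends to infinity along the slab 0 <= h - m <= 1 / (tau + 1), letting eta tend to 0
   shows that h attains its infimum m. With (k0, w0) the centre of a disc touching the set
   {h = m} from outside, the same barrier replaces the exponential in the Hopf lemma and shows that
   {h = m} is open in the surface. Hence h is constant, and the image is open and closed in {h = m}. *)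

theory Submission
  imports Defs
begin

section \<open>The Levi-Civita connection of Heisenberg space\<close>

text \<open>The obstacle is that the orthonormal coframe adapted to the planes is \<open>dh\<close>,
  \<open>dk\<close>, \<open>dw + 2 \<tau> k dh\<close>, whose factor \<open>k\<close> is unbounded.
  With \<open>r\<close> the distance from the centre, \<open>T\<close> the inner logarithm and
  \<open>m = 1 / (r T)\<close>, the first derivatives of G are O(m) and the second ones O(m / r),
  while \<open>k\<close> is O(r); hence all coefficients of the Hessian of G stay bounded. For an
  unnormalised normal \<open>c\<close>, the trace of a form B over the tangent plane, times |c|^2,
  is |c|^2 tr B - B(c, c). The component \<open>c1\<close> across the planes enters squared only
  through the plane Laplacian -4 m^2 of G, and its products with \<open>c2\<close>,
  \<open>c3\<close> carry a coefficient O(m), which is just what Young's inequality can absorb. What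
  remains is \<eta> O(1) times \<open>c2^2 + c3^2\<close>, and loses against the coefficient \<tau>
  - (\<tau> + 1) = -1. The threshold for \<eta> depends on \<tau>, \<open>k0\<close> and a lower
  bound for the squared distance alone, so \<eta> can be fitted afterwards to constants obtained
  from compactness. All analysis is a second derivative test at one point of a chart.\<close>

lemma matrix_inv_eqI:
  fixes A B :: "real ^ 'n ^ 'n"
  assumes "A ** B = mat 1"
  shows "matrix_inv A = B"
proof -
  have BA: "B ** A = mat 1"
    using assms matrix_left_right_inverse by blast
  have "\<exists>B. A ** B = mat 1 \<and> B ** A = mat 1"
    using assms BA by blast
  then have "matrix_inv A ** A = mat 1"
    unfolding matrix_inv_def by (rule someI2_ex) simp
  then have "matrix_inv A ** (A ** B) = B"
    by (simp add: matrix_mul_assoc)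
  then show ?thesis
    using assms by simp
qed

lemma partial_deriv_eq:
  assumes "(F has_derivative F') (at x)"
  shows "partial_deriv i F x = F' (axis i 1)"
  unfolding partial_deriv_def using frechet_derivative_at[OF assms] by simp

lemma has_derivative_vec_nth: "((\<lambda>q. q $ i) has_derivative (\<lambda>v. v $ i)) F"
  for i :: "'n::finite"
  by (rule bounded_linear_imp_has_derivative[OF bounded_linear_vec_nth])

text \<open>Together with \<open>dx\<close> and \<open>dy\<close> an orthonormal coframe; its kernel
  is the horizontal distribution of the fibration. The sign is opposite to the bracket in
  \<open>nil_metric\<close>, which leaves products unchanged.\<close>

definition nil_theta :: "real \<Rightarrow> real ^ 3 \<Rightarrow> real ^ 3 \<Rightarrow> real" where
  "nil_theta \<tau> p v = v $ 3 - 2 * \<tau> * p $ 1 * v $ 2"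

text \<open>The Christoffel symbols contracted with two vectors. Writing them through
  \<open>nil_theta\<close> lets their components in a rotated frame be read off directly.\<close>

definition nil_gamma :: "real \<Rightarrow> real ^ 3 \<Rightarrow> real ^ 3 \<Rightarrow> real ^ 3 \<Rightarrow> real ^ 3" where
  "nil_gamma \<tau> p v w =
     vector [\<tau> * (nil_theta \<tau> p v * w $ 2 + nil_theta \<tau> p w * v $ 2),
       - \<tau> * (nil_theta \<tau> p v * w $ 1 + nil_theta \<tau> p w * v $ 1),
       - \<tau> * (v $ 1 * w $ 2 + v $ 2 * w $ 1)
         - 2 * \<tau>\<^sup>2 * p $ 1 * (v $ 1 * nil_theta \<tau> p w + w $ 1 * nil_theta \<tau> p v)]"

lemma vector_3_2 [simp]: "(vector [a, b, c] :: 'a::zero ^ 3) $ 1 = a"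
  "(vector [a, b, c] :: 'a ^ 3) $ 2 = b" "(vector [a, b, c] :: 'a ^ 3) $ 3 = c"
  by (simp_all add: vector_def)

lemma nil_metric_matrix:
  "metric_matrix (nil_metric \<tau>) q =
     vector [vector [1, 0, 0], vector [0, 1 + 4 * \<tau>\<^sup>2 * (q $ 1)\<^sup>2, - 2 * \<tau> * q $ 1],
       vector [0, - 2 * \<tau> * q $ 1, 1]]"
  unfolding metric_matrix_def nil_metric_def
  by (simp add: vec_eq_iff forall_3 axis_def power2_eq_square)

lemma nil_metric_matrix_inv:
  "matrix_inv (metric_matrix (nil_metric \<tau>) q) =
     vector [vector [1, 0, 0], vector [0, 1, 2 * \<tau> * q $ 1],
       vector [0, 2 * \<tau> * q $ 1, 1 + 4 * \<tau>\<^sup>2 * (q $ 1)\<^sup>2]]"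
  unfolding nil_metric_matrix
  by (rule matrix_inv_eqI)
     (simp add: vec_eq_iff forall_3 matrix_matrix_mult_def sum_3 mat_def power2_eq_square)

lemma partial_deriv_nil_metric_matrix:
  "partial_deriv l (\<lambda>q. metric_matrix (nil_metric \<tau>) q $ i $ j) p =
     (if l = 1 then
        (if i = 2 \<and> j = 2 then 8 * \<tau>\<^sup>2 * p $ 1
         else if i = 2 \<and> j = 3 \<or> i = 3 \<and> j = 2 then - 2 * \<tau> else 0)
      else 0)"
proof -
  have 1: "partial_deriv l (\<lambda>q. - (2 * \<tau> * q $ 1)) p = (if l = 1 then - 2 * \<tau> else 0)"
    by (subst partial_deriv_eq[OF has_derivative_minus[OF has_derivative_mult_right[OF
      has_derivative_vec_nth]]]) (simp add: axis_def)
  have 2: "partial_deriv l (\<lambda>q. 1 + 4 * \<tau>\<^sup>2 * (q $ 1)\<^sup>2) p = (if l = 1 then 8 * \<tau>\<^sup>2 * p $ 1 else 0)"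
    by (subst partial_deriv_eq[OF has_derivative_add[OF has_derivative_const
      has_derivative_mult_right[OF has_derivative_power[OF has_derivative_vec_nth]]]])
      (simp add: axis_def)
  have 3: "partial_deriv l (\<lambda>q. c) p = 0" for c :: real
    by (subst partial_deriv_eq[where F' = "\<lambda>v. 0"]) auto
  show ?thesis
    unfolding nil_metric_matrix
    using exhaust_3[of i] exhaust_3[of j] by (elim disjE) (simp_all add: 1 2 3)
qed

lemma christoffel_nil:
  "christoffel (nil_metric \<tau>) k i j p = nil_gamma \<tau> p (axis i 1) (axis j 1) $ k"
  unfolding christoffel_def nil_metric_matrix_inv partial_deriv_nil_metric_matrix
    nil_gamma_def nil_theta_def
  using exhaust_3[of k] exhaust_3[of i] exhaust_3[of j]
  by (elim disjE; simp only: sum_3 vector_3_2 axis_def vec_lambda_beta; simp)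
    (simp_all add: power2_eq_square algebra_simps)

lemma cov_deriv_nil:
  "cov_deriv (nil_metric \<tau>) X i j u =
     partial_deriv i (partial_deriv j X) u
       + nil_gamma \<tau> (X u) (partial_deriv i X u) (partial_deriv j X u)"
  unfolding cov_deriv_def christoffel_nil nil_gamma_def nil_theta_def
  by (simp add: vec_eq_iff forall_3 sum_3 axis_def algebra_simps power2_eq_square)

section \<open>Traces over the tangent plane of a minimal surface\<close>

lemma matrix_inv_2:
  fixes A :: "real ^ 2 ^ 2"
  assumes "A $ 1 $ 1 * A $ 2 $ 2 - A $ 1 $ 2 * A $ 2 $ 1 \<noteq> 0" (is "?D \<noteq> 0")
  shows "matrix_inv A =
    vector [vector [A $ 2 $ 2 / ?D, - A $ 1 $ 2 / ?D], vector [- A $ 2 $ 1 / ?D, A $ 1 $ 1 / ?D]]"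
proof (rule matrix_inv_eqI)
  have a: "x / ?D - y / ?D = (x - y) / ?D" for x y
    by (simp add: diff_divide_distrib)
  show "A ** vector [vector [A $ 2 $ 2 / ?D, - A $ 1 $ 2 / ?D],
      vector [- A $ 2 $ 1 / ?D, A $ 1 $ 1 / ?D]] = mat 1"
    using assms
    by (simp add: vec_eq_iff forall_2 matrix_matrix_mult_def sum_2 mat_def a mult.commute)
qed

text \<open>Multiplication by the determinant of the first fundamental form replaces its inverse by
  the adjugate. All later traces over the tangent plane are taken in this unnormalised form and so
  remain polynomial in the frame components.\<close>

lemma mean_curvature_eq_0D:
  assumes "mean_curvature g X u n = 0"
    and "E = g (X u) (partial_deriv 1 X u) (partial_deriv 1 X u)"
    and "F = g (X u) (partial_deriv 1 X u) (partial_deriv 2 X u)"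
    and "F = g (X u) (partial_deriv 2 X u) (partial_deriv 1 X u)"
    and "G = g (X u) (partial_deriv 2 X u) (partial_deriv 2 X u)"
    and D: "E * G - F\<^sup>2 \<noteq> 0"
    and b: "\<And>i j. b i j = g (X u) (cov_deriv g X i j u) n"
  shows "G * b 1 1 - F * (b 1 2 + b 2 1) + E * b 2 2 = 0"
proof -
  define A where "A = first_fundamental_form g X u"
  have A: "A $ 1 $ 1 = E" "A $ 1 $ 2 = F" "A $ 2 $ 1 = F" "A $ 2 $ 2 = G"
    using assms(2-5) unfolding A_def first_fundamental_form_def by simp_all
  have inv: "matrix_inv A = vector [vector [G / (E * G - F\<^sup>2), - F / (E * G - F\<^sup>2)],
      vector [- F / (E * G - F\<^sup>2), E / (E * G - F\<^sup>2)]]"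
    using matrix_inv_2[of A] D by (simp add: A power2_eq_square)
  have "0 = trace (matrix_inv A ** second_fundamental_form g X u n)"
    using assms(1) by (simp add: mean_curvature_def A_def)
  also have "\<dots> = (G / (E * G - F\<^sup>2)) * b 1 1 - F / (E * G - F\<^sup>2) * (b 1 2 + b 2 1)
      + E / (E * G - F\<^sup>2) * b 2 2"
    unfolding inv second_fundamental_form_def
    by (simp add: trace_def sum_2 matrix_matrix_mult_def b[symmetric] algebra_simps add_divide_distrib)
  also have "\<dots> = (G * b 1 1 - F * (b 1 2 + b 2 1) + E * b 2 2) / (E * G - F\<^sup>2)"
    by (simp add: add_divide_distrib diff_divide_distrib)
  finally show ?thesis
    using D by simp
qed

lemma nil_metric_theta:
  "nil_metric \<tau> p v w = v $ 1 * w $ 1 + v $ 2 * w $ 2 + nil_theta \<tau> p v * nil_theta \<tau> p w"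
  by (simp add: nil_metric_def nil_theta_def algebra_simps)

text \<open>A linear functional vanishing on the tangent plane is a multiple of pairing with the normal, so
  minimality makes it vanish on the trace of the covariant derivatives.\<close>

lemma minimal_conormal_trace:
  fixes X :: "real ^ 2 \<Rightarrow> real ^ 3" and u and l :: "real ^ 3 \<Rightarrow> real"
  defines "V \<equiv> \<lambda>i::2. partial_deriv i X u"
  assumes min: "\<And>n. unit_normal (nil_metric \<tau>) X u n \<Longrightarrow> mean_curvature (nil_metric \<tau>) X u n = 0"
    and E: "E = nil_metric \<tau> (X u) (V 1) (V 1)"
    and F: "F = nil_metric \<tau> (X u) (V 1) (V 2)"
    and G: "G = nil_metric \<tau> (X u) (V 2) (V 2)"
    and D: "E * G - F\<^sup>2 > 0"
    and l: "linear l" "l (V 1) = 0" "l (V 2) = 0"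
    and b: "\<And>i j. b i j = l (cov_deriv (nil_metric \<tau>) X i j u)"
  shows "G * b 1 1 - F * (b 1 2 + b 2 1) + E * b 2 2 = 0"
proof -
  let ?\<theta> = "nil_theta \<tau> (X u)" and ?x = "X u $ 1"
  define p1 p2 p3 q1 q2 q3 where pq: "p1 = V 1 $ 1" "p2 = V 1 $ 2" "p3 = ?\<theta> (V 1)"
    "q1 = V 2 $ 1" "q2 = V 2 $ 2" "q3 = ?\<theta> (V 2)"
  \<comment> \<open>The cross product of the tangent vectors in the orthonormal coframe; by
    Lagrange's identity its squared length is \<open>E * G - F\<^sup>2\<close>.\<close>
  define c1 c2 c3 where c: "c1 = p2 * q3 - p3 * q2" "c2 = p3 * q1 - p1 * q3" "c3 = p1 * q2 - p2 * q1"
  define S where "S = E * G - F\<^sup>2"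
  have S: "S = c1\<^sup>2 + c2\<^sup>2 + c3\<^sup>2"
    unfolding S_def E F G c nil_metric_theta pq[symmetric] power2_eq_square by (simp add: algebra_simps)
  \<comment> \<open>The last coordinate converts back from the coframe: \<open>dz\<close> is theta
    plus \<open>2 \<tau> x dy\<close>.\<close>
  define n :: "real ^ 3" where "n = vector [c1 / sqrt S, c2 / sqrt S, (c3 + 2 * \<tau> * ?x * c2) / sqrt S]"
  have n: "n $ 1 = c1 / sqrt S" "n $ 2 = c2 / sqrt S" "?\<theta> n = c3 / sqrt S"
    by (simp_all add: n_def nil_theta_def add_divide_distrib)
  have S0: "S > 0" using D S_def by simp
  have gn: "nil_metric \<tau> (X u) w n = (c1 * w $ 1 + c2 * w $ 2 + c3 * ?\<theta> w) / sqrt S" for w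
    by (simp add: nil_metric_theta n add_divide_distrib mult.commute)
  have "nil_metric \<tau> (X u) n n = (c1\<^sup>2 + c2\<^sup>2 + c3\<^sup>2) / (sqrt S * sqrt S)"
    by (simp add: gn n add_divide_distrib power2_eq_square)
  then have nn: "nil_metric \<tau> (X u) n n = 1"
    using S0 S by simp
  have comm: "nil_metric \<tau> (X u) n w = nil_metric \<tau> (X u) w n" for w
    by (simp add: nil_metric_def mult.commute)
  have "nil_metric \<tau> (X u) n (V i) = 0" for i
    unfolding comm gn using exhaust_2[of i] by (auto simp: pq[symmetric] c algebra_simps)
  then have un: "unit_normal (nil_metric \<tau>) X u n"
    using nn unfolding unit_normal_def V_def by blast
  have Y: "l y = l (axis 1 1) * y $ 1 + (l (axis 2 1) + 2 * \<tau> * ?x * l (axis 3 1)) * y $ 2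
      + l (axis 3 1) * ?\<theta> y" for y
  proof -
    have "y = y $ 1 *\<^sub>R axis 1 1 + y $ 2 *\<^sub>R axis 2 1 + y $ 3 *\<^sub>R axis 3 1"
      by (simp add: vec_eq_iff forall_3 axis_def)
    from arg_cong[OF this, of l]
    have "l y = y $ 1 * l (axis 1 1) + y $ 2 * l (axis 2 1) + y $ 3 * l (axis 3 1)"
      by (simp only: linear_add[OF l(1)] linear_scale[OF l(1)] real_scaleR_def)
    then show ?thesis
      by (simp add: nil_theta_def algebra_simps)
  qed
  define L1 L2 L3 where L: "L1 = l (axis 1 1)" "L2 = l (axis 2 1) + 2 * \<tau> * ?x * l (axis 3 1)"
    "L3 = l (axis 3 1)"
  have lY: "l y = L1 * y $ 1 + L2 * y $ 2 + L3 * ?\<theta> y" for y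
    unfolding L by (rule Y)
  have Lp: "L1 * p1 + L2 * p2 + L3 * p3 = 0" and Lq: "L1 * q1 + L2 * q2 + L3 * q3 = 0"
    using l(2,3) unfolding lY pq by simp_all
  \<comment> \<open>\<open>L\<close> and \<open>c\<close> are both orthogonal to \<open>p\<close>
    and \<open>q\<close>, so their cross product vanishes. This yields |c|^2 L = (L . c) c, the
    identity behind \<open>Sl\<close>.\<close>
  have cL: "c1 * L2 = c2 * L1" "c2 * L3 = c3 * L2" "c3 * L1 = c1 * L3"
    unfolding c using Lp Lq by algebra+
  have Sl: "S * l y = (L1 * c1 + L2 * c2 + L3 * c3) * sqrt S * nil_metric \<tau> (X u) y n" for y
  proof -
    have "S * l y = (L1 * c1 + L2 * c2 + L3 * c3) * (c1 * y $ 1 + c2 * y $ 2 + c3 * ?\<theta> y)"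
      unfolding lY S using cL by algebra
    then show ?thesis
      using S0 by (simp add: gn)
  qed
  define bn where "bn i j = nil_metric \<tau> (X u) (cov_deriv (nil_metric \<tau>) X i j u) n" for i j
  have bn0: "G * bn 1 1 - F * (bn 1 2 + bn 2 1) + E * bn 2 2 = 0"
  proof (rule mean_curvature_eq_0D[OF min[OF un]])
    show "F = nil_metric \<tau> (X u) (partial_deriv 2 X u) (partial_deriv 1 X u)"
      unfolding F V_def by (simp add: nil_metric_def mult.commute)
  qed (use D in \<open>simp_all add: E F G V_def bn_def\<close>)
  have Sb: "S * b i j = (L1 * c1 + L2 * c2 + L3 * c3) * sqrt S * bn i j" for i j
    unfolding b bn_def by (rule Sl)
  have "S * (G * b 1 1 - F * (b 1 2 + b 2 1) + E * b 2 2) = 0"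
    using bn0 Sb[of 1 1] Sb[of 1 2] Sb[of 2 1] Sb[of 2 2] by algebra
  then show ?thesis
    using S0 by simp
qed

text \<open>The Gram determinant is the squared length of a cross product in the orthonormal
  coframe, so it vanishes only for dependent tangent vectors, which injectivity of the differential
  excludes.\<close>

lemma gram_pos:
  fixes X :: "real ^ 2 \<Rightarrow> real ^ 3" and u
  defines "V \<equiv> \<lambda>i::2. partial_deriv i X u"
  assumes X: "(X has_derivative X') (at u)" and inj: "inj X'"
  shows "nil_metric \<tau> (X u) (V 1) (V 1) > 0"
    and "nil_metric \<tau> (X u) (V 1) (V 1) * nil_metric \<tau> (X u) (V 2) (V 2)
      - (nil_metric \<tau> (X u) (V 1) (V 2))\<^sup>2 > 0"
proof -
  let ?\<theta> = "nil_theta \<tau> (X u)"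
  have lin: "linear X'"
    using X has_derivative_linear by blast
  have V: "X' (axis 1 1) = V 1" "X' (axis 2 1) = V 2"
    unfolding V_def using partial_deriv_eq[OF X] by simp_all
  have indep: "\<alpha> = 0 \<and> \<beta> = 0" if "\<alpha> *\<^sub>R V 1 + \<beta> *\<^sub>R V 2 = 0" for \<alpha> \<beta>
  proof -
    have "X' (\<alpha> *\<^sub>R axis 1 1 + \<beta> *\<^sub>R axis 2 1) = X' 0"
      using that V lin by (simp add: linear_add linear_scale linear_0)
    then have "\<alpha> *\<^sub>R axis 1 1 + \<beta> *\<^sub>R axis 2 1 = (0 :: real ^ 2)"
      using inj by (simp add: inj_eq)
    then show ?thesis
      by (simp add: vec_eq_iff forall_2 axis_def)
  qed
  have eq0: "y = 0" if "y $ 1 = 0" "y $ 2 = 0" "?\<theta> y = 0" for y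
    using that by (simp add: vec_eq_iff forall_3 nil_theta_def)
  have V1: "V 1 \<noteq> 0"
    using indep[of 1 0] by auto
  have sq: "x\<^sup>2 + y\<^sup>2 + z\<^sup>2 > 0" if "\<not> (x = 0 \<and> y = 0 \<and> z = 0)" for x y z :: real
    using that by (metis add_nonneg_nonneg add_nonneg_pos add_pos_nonneg zero_le_power2 zero_less_power2)
  show "nil_metric \<tau> (X u) (V 1) (V 1) > 0"
    using sq[of "V 1 $ 1" "V 1 $ 2" "?\<theta> (V 1)"] eq0[of "V 1"] V1
    by (auto simp: nil_metric_theta power2_eq_square)
  define p1 p2 p3 q1 q2 q3 where pq: "p1 = V 1 $ 1" "p2 = V 1 $ 2" "p3 = ?\<theta> (V 1)"
    "q1 = V 2 $ 1" "q2 = V 2 $ 2" "q3 = ?\<theta> (V 2)"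
  have "\<not> (p2 * q3 - p3 * q2 = 0 \<and> p3 * q1 - p1 * q3 = 0 \<and> p1 * q2 - p2 * q1 = 0)"
  proof
    assume 0: "p2 * q3 - p3 * q2 = 0 \<and> p3 * q1 - p1 * q3 = 0 \<and> p1 * q2 - p2 * q1 = 0"
    \<comment> \<open>With a vanishing cross product, the combination of \<open>V 1\<close> and
      \<open>V 2\<close> with coefficients \<open>q_i\<close> and \<open>- p_i\<close> is zero for
      each index \<open>i\<close>; independence then forces every \<open>p_i\<close> to vanish,
      against \<open>V 1 \<noteq> 0\<close>.\<close>
    have "\<beta> *\<^sub>R V 1 + (- \<alpha>) *\<^sub>R V 2 = 0" if "(\<alpha>, \<beta>) \<in> {(p1, q1), (p2, q2), (p3, q3)}" for \<alpha> \<beta>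
    proof (rule eq0)
      show "(\<beta> *\<^sub>R V 1 + (- \<alpha>) *\<^sub>R V 2) $ 1 = 0" "(\<beta> *\<^sub>R V 1 + (- \<alpha>) *\<^sub>R V 2) $ 2 = 0"
        using that 0 by (auto simp: pq[symmetric] algebra_simps)
      have "?\<theta> (\<beta> *\<^sub>R V 1 + (- \<alpha>) *\<^sub>R V 2) = \<beta> * p3 - \<alpha> * q3"
        by (simp add: pq nil_theta_def algebra_simps)
      then show "?\<theta> (\<beta> *\<^sub>R V 1 + (- \<alpha>) *\<^sub>R V 2) = 0"
        using that 0 by (auto simp: algebra_simps)
    qed
    then have "p1 = 0" "p2 = 0" "p3 = 0"
      using indep by (metis insertCI neg_equal_0_iff_equal)+
    then show False
      using eq0[of "V 1"] V1 pq by simp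
  qed
  from sq[OF this] show "nil_metric \<tau> (X u) (V 1) (V 1) * nil_metric \<tau> (X u) (V 2) (V 2)
      - (nil_metric \<tau> (X u) (V 1) (V 2))\<^sup>2 > 0"
    unfolding nil_metric_theta pq[symmetric] power2_eq_square by (simp add: algebra_simps)
qed

section \<open>Trace formulas for quadratic forms and the sign of the barrier form\<close>

text \<open>Gram-Schmidt: \<open>V 1\<close> and \<open>F V 1 - E V 2\<close> are orthogonal, so
  \<open>E\<close> times the trace is a nonnegative combination of the values of the form at the
  coefficient pairs \<open>(1, 0)\<close> and \<open>(F, - E)\<close>.\<close>

lemma gram_trace_nonneg:
  fixes E F G :: real
  assumes "E > 0" "E * G - F\<^sup>2 > 0"
    and a: "\<And>P Q. P\<^sup>2 * a11 + P * Q * (a12 + a21) + Q\<^sup>2 * a22 \<ge> 0"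
  shows "G * a11 - F * (a12 + a21) + E * a22 \<ge> 0"
proof -
  have "(E * G - F\<^sup>2) * a11 \<ge> 0"
    using a[of 1 0] assms(2) by simp
  then have "0 \<le> (E * G - F\<^sup>2) * a11 + (F\<^sup>2 * a11 + F * (- E) * (a12 + a21) + (- E)\<^sup>2 * a22)"
    using a[of F "- E"] by linarith
  also have "\<dots> = E * (G * a11 - F * (a12 + a21) + E * a22)"
    by algebra
  finally show ?thesis
    using assms(1) by (simp add: zero_le_mult_iff)
qed

text \<open>The trace over a plane is the full trace minus the value on the unit normal; the factor
  |c|^2 clears denominators and gives |c|^2 tr B - B(c, c). The halves make each mixed
  \<open>Aij\<close> the coefficient in the quadratic form of \<open>B\<close>.\<close>

lemma frame_form_trace:
  fixes p1 p2 p3 q1 q2 q3 :: real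
  assumes B: "\<And>x1 x2 x3 y1 y2 y3. B x1 x2 x3 y1 y2 y3 = A11 * x1 * y1 + A22 * x2 * y2 + A33 * x3 * y3
      + (A12 * (x1 * y2 + x2 * y1) + A13 * (x1 * y3 + x3 * y1) + A23 * (x2 * y3 + x3 * y2)) / 2"
    and c: "c1 = p2 * q3 - p3 * q2" "c2 = p3 * q1 - p1 * q3" "c3 = p1 * q2 - p2 * q1"
  shows "(q1\<^sup>2 + q2\<^sup>2 + q3\<^sup>2) * B p1 p2 p3 p1 p2 p3
      - (p1 * q1 + p2 * q2 + p3 * q3) * (B p1 p2 p3 q1 q2 q3 + B q1 q2 q3 p1 p2 p3)
      + (p1\<^sup>2 + p2\<^sup>2 + p3\<^sup>2) * B q1 q2 q3 q1 q2 q3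
    = A11 * (c2\<^sup>2 + c3\<^sup>2) + A22 * (c1\<^sup>2 + c3\<^sup>2) + A33 * (c1\<^sup>2 + c2\<^sup>2)
      - A12 * c1 * c2 - A13 * c1 * c3 - A23 * c2 * c3"
proof -
  obtain h12 h13 h23 where h: "A12 = 2 * h12" "A13 = 2 * h13" "A23 = 2 * h23"
    by (metis field_sum_of_halves mult_2)
  have B': "B x1 x2 x3 y1 y2 y3 = A11 * x1 * y1 + A22 * x2 * y2 + A33 * x3 * y3
      + h12 * (x1 * y2 + x2 * y1) + h13 * (x1 * y3 + x3 * y1) + h23 * (x2 * y3 + x3 * y2)"
    for x1 x2 x3 y1 y2 y3
    unfolding B h by simp
  show ?thesis
    unfolding B' c h power2_eq_square by (simp add: algebra_simps)
qed

text \<open>\<open>c\<close> is a normal with first component across the planes, and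
  \<open>s\<close> measures the tilt. The term with \<open>2 * \<tau> * \<phi>1\<close> costs at
  most \<open>\<tau> * s\<close>, which leaves \<open>- s\<close> of \<open>\<phi>2 * s\<close>. Of
  the error \<open>\<eta> * (3 * C + C\<^sup>2) * s\<close>, the three \<open>C\<close> come from
  \<open>g11\<close>, from the pair \<open>g22\<close>, \<open>g33\<close> and from
  \<open>g23\<close>; the square comes from Young's inequality for \<open>g12\<close> and
  \<open>g13\<close>.\<close>

lemma barrier_form_neg:
  fixes \<tau> \<eta> C m :: real
  assumes "\<tau> \<ge> 0" "0 < \<eta>" "\<eta> * (3 * C + C\<^sup>2) < 1" "C \<ge> 0" "m > 0"
    and \<phi>: "\<bar>\<phi>1\<bar> \<le> 1" "\<phi>2 = - (\<tau> + 1)"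
    and g: "\<bar>g22\<bar> \<le> C" "\<bar>g33\<bar> \<le> C" "g11 \<le> C" "\<bar>g23\<bar> \<le> C" "\<bar>g12\<bar> \<le> C * m" "\<bar>g13\<bar> \<le> C * m"
      "g22 + g33 \<le> - 4 * m\<^sup>2"
    and c: "c1\<^sup>2 + c2\<^sup>2 + c3\<^sup>2 > 0"
  shows "(\<phi>2 + \<eta> * g11) * (c2\<^sup>2 + c3\<^sup>2) + \<eta> * g22 * (c1\<^sup>2 + c3\<^sup>2) + \<eta> * g33 * (c1\<^sup>2 + c2\<^sup>2)
      - \<eta> * g12 * c1 * c2 - \<eta> * g13 * c1 * c3 - (- 2 * \<tau> * \<phi>1 + \<eta> * g23) * c2 * c3 < 0"
    (is "?L < 0")
proof -
  define s where "s = c2\<^sup>2 + c3\<^sup>2"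
  have s0: "s \<ge> 0" by (simp add: s_def)
  have cc: "2 * \<bar>c2 * c3\<bar> \<le> s"
    unfolding s_def abs_mult using sum_squares_bound[of "\<bar>c2\<bar>" "\<bar>c3\<bar>"] by simp
  have 1: "2 * \<tau> * \<phi>1 * (c2 * c3) \<le> \<tau> * s"
  proof -
    have "\<phi>1 * (c2 * c3) \<le> \<bar>\<phi>1\<bar> * \<bar>c2 * c3\<bar>" by (metis abs_ge_self abs_mult)
    also have "\<dots> \<le> 1 * \<bar>c2 * c3\<bar>" by (rule mult_right_mono) (use \<phi> in auto)
    finally have "2 * (\<phi>1 * (c2 * c3)) \<le> s" using cc by linarith
    from mult_left_mono[OF this \<open>\<tau> \<ge> 0\<close>] show ?thesis by (simp add: algebra_simps)
  qed
  have 2: "g11 * s \<le> C * s" using g(3) s0 by (rule mult_right_mono)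
  have 3: "g22 * c3\<^sup>2 + g33 * c2\<^sup>2 \<le> C * s"
  proof -
    have "g22 * c3\<^sup>2 \<le> C * c3\<^sup>2" "g33 * c2\<^sup>2 \<le> C * c2\<^sup>2" using g(1,2) by (auto intro!: mult_right_mono)
    then show ?thesis by (simp add: s_def algebra_simps)
  qed
  have 4: "- (g23 * (c2 * c3)) \<le> C * s"
  proof -
    have "- (g23 * (c2 * c3)) \<le> \<bar>g23\<bar> * \<bar>c2 * c3\<bar>" by (metis abs_ge_minus_self abs_mult)
    also have "\<dots> \<le> C * \<bar>c2 * c3\<bar>" by (rule mult_right_mono) (use g in auto)
    also have "\<dots> \<le> C * s" by (rule mult_left_mono) (use cc \<open>C \<ge> 0\<close> in auto)
    finally show ?thesis .
  qed
  \<comment> \<open>Applied to both \<open>g12\<close> and \<open>g13\<close>, this spends two of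
    the four units of \<open>m\<^sup>2 * c1\<^sup>2\<close> provided by \<open>6\<close>. The other
    two make the total negative when \<open>s = 0\<close>, that is, at a tangency.\<close>
  have 5: "- (h * c1 * d) \<le> m\<^sup>2 * c1\<^sup>2 + C\<^sup>2 * d\<^sup>2" if "\<bar>h\<bar> \<le> C * m" for h d
  proof -
    have "- (h * c1 * d) \<le> \<bar>h\<bar> * \<bar>c1 * d\<bar>" by (metis abs_ge_minus_self abs_mult mult.assoc)
    also have "\<dots> \<le> C * m * \<bar>c1 * d\<bar>" by (rule mult_right_mono) (use that in auto)
    also have "\<dots> = (m * \<bar>c1\<bar>) * (C * \<bar>d\<bar>)" by (simp add: abs_mult)
    also have "\<dots> \<le> (m * \<bar>c1\<bar>)\<^sup>2 + (C * \<bar>d\<bar>)\<^sup>2"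
    proof -
      have "0 \<le> (m * \<bar>c1\<bar>) * (C * \<bar>d\<bar>)"
        using \<open>C \<ge> 0\<close> \<open>m > 0\<close> by simp
      then show ?thesis
        using sum_squares_bound[of "m * \<bar>c1\<bar>" "C * \<bar>d\<bar>"] by linarith
    qed
    finally show ?thesis by (simp add: power_mult_distrib)
  qed
  have 6: "(g22 + g33) * c1\<^sup>2 \<le> - 4 * m\<^sup>2 * c1\<^sup>2"
    by (rule mult_right_mono) (use g in auto)
  have "g11 * s + (g22 + g33) * c1\<^sup>2 + (g22 * c3\<^sup>2 + g33 * c2\<^sup>2) - (g12 * c1 * c2) - (g13 * c1 * c3)
      - g23 * (c2 * c3) \<le> (3 * C + C\<^sup>2) * s - 2 * m\<^sup>2 * c1\<^sup>2"
    using 2 3 4 5[OF g(5), of c2] 5[OF g(6), of c3] 6 unfolding s_def by (simp add: algebra_simps)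
  from mult_left_mono[OF this, of \<eta>] have
    "?L \<le> \<eta> * ((3 * C + C\<^sup>2) * s - 2 * m\<^sup>2 * c1\<^sup>2) + \<phi>2 * s + \<tau> * s"
    using 1 \<open>0 < \<eta>\<close> unfolding s_def by (simp add: algebra_simps)
  also have "\<dots> = - (1 - \<eta> * (3 * C + C\<^sup>2)) * s - 2 * \<eta> * m\<^sup>2 * c1\<^sup>2"
    by (simp add: \<phi> algebra_simps)
  also have "\<dots> < 0"
  proof (cases "s = 0")
    case True
    then have "c1\<^sup>2 > 0" using c s_def by simp
    then show ?thesis using True assms by (simp add: mult_pos_pos)
  next
    case False
    then have "(1 - \<eta> * (3 * C + C\<^sup>2)) * s > 0" using s0 assms(3) by simp
    moreover have "2 * \<eta> * m\<^sup>2 * c1\<^sup>2 \<ge> 0" using assms by simp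
    ultimately show ?thesis by linarith
  qed
  finally show ?thesis .
qed

section \<open>Second derivatives of the barrier\<close>

lemma second_derivative_nonneg:
  fixes f f' :: "real \<Rightarrow> real"
  assumes f: "\<forall>\<^sub>F t in nhds t0. (f has_real_derivative f' t) (at t)"
    and f': "(f' has_real_derivative D) (at t0)"
    and min: "\<forall>\<^sub>F t in nhds t0. f t0 \<le> f t"
  shows "f' t0 = 0" "D \<ge> 0"
proof -
  obtain d where d: "d > 0" "\<And>t. dist t t0 < d \<Longrightarrow> (f has_real_derivative f' t) (at t)"
    "\<And>t. dist t t0 < d \<Longrightarrow> f t0 \<le> f t"
    using eventually_conj[OF f min] unfolding eventually_nhds_metric by auto
  show zero: "f' t0 = 0"
    by (rule DERIV_local_min[OF d(2)[of t0] d(1)])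
      (use d in \<open>auto simp: dist_real_def abs_minus_commute\<close>)
  show "D \<ge> 0"
  proof (rule ccontr)
    assume "\<not> D \<ge> 0"
    then obtain e where e: "e > 0" "\<And>h. h > 0 \<Longrightarrow> h < e \<Longrightarrow> f' (t0 + h) < f' t0"
      using DERIV_neg_dec_right[OF f'] by auto
    define h where "h = min d e / 2"
    have h: "0 < h" "h < d" "h < e"
      using d(1) e(1) by (auto simp: h_def min_def)
    obtain z where z: "t0 < z" "z < t0 + h" "f (t0 + h) - f t0 = (t0 + h - t0) * f' z"
      using MVT2[of t0 "t0 + h" f f'] d(2) h by (auto simp: dist_real_def)
    have "f' z < 0"
      using e(2)[of "z - t0"] z h zero by auto
    then have "f (t0 + h) - f t0 < 0"
      using z(3) h(1) by (simp add: mult_pos_neg)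
    then show False
      using d(3)[of "t0 + h"] h by (simp add: dist_real_def)
  qed
qed

text \<open>Restriction to parameter lines turns the Hessian of a function on the surface into
  ordinary second derivatives, one for each direction \<open>P\<close>; the resulting quadratic form
  in \<open>P\<close> is what \<open>gram_trace_nonneg\<close> consumes.\<close>

lemma smooth_on_along_line:
  fixes X :: "real ^ 2 \<Rightarrow> real ^ 3" and u P :: "real ^ 2"
  assumes \<Omega>: "open \<Omega>" "u \<in> \<Omega>" and X: "smooth_on \<Omega> X"
  defines "V \<equiv> \<lambda>t. P $ 1 *\<^sub>R partial_deriv 1 X (u + t *\<^sub>R P) + P $ 2 *\<^sub>R partial_deriv 2 X (u + t *\<^sub>R P)"
    and "W \<equiv> \<lambda>i j. partial_deriv i (partial_deriv j X) u"
  shows "\<forall>\<^sub>F t in nhds 0. ((\<lambda>t. X (u + t *\<^sub>R P)) has_vector_derivative V t) (at t)"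
    and "(V has_vector_derivative ((P $ 1)\<^sup>2 *\<^sub>R W 1 1 + (P $ 1 * P $ 2) *\<^sub>R (W 1 2 + W 2 1)
      + (P $ 2)\<^sup>2 *\<^sub>R W 2 2)) (at 0)"
proof -
  have dX: "X differentiable (at x)" if "x \<in> \<Omega>" for x
    using X that unfolding smooth_on_def by (metis Ck_on.simps(2))
  have dP: "partial_deriv j X differentiable (at x)" if "x \<in> \<Omega>" for x j
  proof -
    have "Ck_on (Suc (Suc 0)) \<Omega> X"
      using X unfolding smooth_on_def by blast
    then show ?thesis
      using that by (simp add: partial_deriv_def[abs_def])
  qed
  have P: "P = P $ 1 *\<^sub>R axis 1 1 + P $ 2 *\<^sub>R axis 2 1"
    by (simp add: vec_eq_iff forall_2 axis_def)
  have lin: "frechet_derivative F (at x) P =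
      P $ 1 *\<^sub>R partial_deriv 1 F x + P $ 2 *\<^sub>R partial_deriv 2 F x"
    if "F differentiable (at x)" for F :: "real ^ 2 \<Rightarrow> real ^ 3" and x
    using linear_frechet_derivative[OF that] unfolding partial_deriv_def
    by (subst (1) P) (simp add: linear_add linear_scale)
  have line: "((\<lambda>t. F (u + t *\<^sub>R P)) has_vector_derivative
      (P $ 1 *\<^sub>R partial_deriv 1 F (u + t *\<^sub>R P) + P $ 2 *\<^sub>R partial_deriv 2 F (u + t *\<^sub>R P))) (at t)"
    if "F differentiable (at (u + t *\<^sub>R P))" for F :: "real ^ 2 \<Rightarrow> real ^ 3" and t
  proof -
    have 1: "((\<lambda>t. u + t *\<^sub>R P) has_vector_derivative P) (at t)"
      by (auto intro!: derivative_eq_intros)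
    have 2: "(F has_derivative frechet_derivative F (at (u + t *\<^sub>R P))) (at (u + t *\<^sub>R P))"
      using that frechet_derivative_works by blast
    have "(F \<circ> (\<lambda>t. u + t *\<^sub>R P) has_vector_derivative frechet_derivative F (at (u + t *\<^sub>R P)) P) (at t)"
      by (rule vector_derivative_diff_chain_within[OF 1])
        (use 2 in \<open>auto intro: has_derivative_at_withinI\<close>)
    then show ?thesis
      unfolding lin[OF that] by (simp add: o_def)
  qed
  have "((\<lambda>t. u + t *\<^sub>R P) \<longlongrightarrow> u + 0 *\<^sub>R P) (nhds 0)"
    by (intro tendsto_intros filterlim_ident)
  then have "\<forall>\<^sub>F t in nhds 0. u + t *\<^sub>R P \<in> \<Omega>"
    using \<Omega> by (auto elim!: topological_tendstoD)
  then show "\<forall>\<^sub>F t in nhds 0. ((\<lambda>t. X (u + t *\<^sub>R P)) has_vector_derivative V t) (at t)"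
    by eventually_elim (auto simp: V_def intro!: line dX)
  have "((\<lambda>t. partial_deriv j X (u + t *\<^sub>R P)) has_vector_derivative
      (P $ 1 *\<^sub>R W 1 j + P $ 2 *\<^sub>R W 2 j)) (at 0)" for j
    using line[of "partial_deriv j X" 0] dP[OF \<Omega>(2)] by (simp add: W_def)
  note D = this
  have "(V has_vector_derivative (P $ 1 *\<^sub>R (P $ 1 *\<^sub>R W 1 1 + P $ 2 *\<^sub>R W 2 1)
      + P $ 2 *\<^sub>R (P $ 1 *\<^sub>R W 1 2 + P $ 2 *\<^sub>R W 2 2))) (at 0)"
    unfolding V_def
    by (intro has_vector_derivative_add has_vector_derivative_scaleR[THEN has_vector_derivative_eq_rhs]
        bounded_linear.has_vector_derivative[OF bounded_linear_scaleR_right] D)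
  then show "(V has_vector_derivative ((P $ 1)\<^sup>2 *\<^sub>R W 1 1 + (P $ 1 * P $ 2) *\<^sub>R (W 1 2 + W 2 1)
      + (P $ 2)\<^sup>2 *\<^sub>R W 2 2)) (at 0)"
    by (simp add: algebra_simps power2_eq_square)
qed

text \<open>The abbreviations \<open>gk\<close>, \<open>gw\<close> and \<open>gkk\<close>,
  \<open>gkw\<close>, \<open>gww\<close> are the first and second partial derivatives of
  \<open>ln (c + ln \<rho>)\<close> in the plane coordinates, so the conclusions are the chain rule
  combined with the derivative tests at a minimum.\<close>

lemma barrier_second_derivative:
  fixes h h1 k k1 w w1 :: "real \<Rightarrow> real" and h2 k2 w2 k0 w0 c m B \<eta> :: real
  assumes ev: "\<forall>\<^sub>F t in nhds 0. (h has_real_derivative h1 t) (at t)"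
    "\<forall>\<^sub>F t in nhds 0. (k has_real_derivative k1 t) (at t)"
    "\<forall>\<^sub>F t in nhds 0. (w has_real_derivative w1 t) (at t)"
    and d: "(h1 has_real_derivative h2) (at 0)" "(k1 has_real_derivative k2) (at 0)"
    "(w1 has_real_derivative w2) (at 0)"
  defines "\<rho> \<equiv> \<lambda>t. (k t - k0)\<^sup>2 + (w t - w0)\<^sup>2"
  defines "T \<equiv> \<lambda>t. c + ln (\<rho> t)"
  assumes pos: "\<rho> 0 > 0" "T 0 > 0"
    and min: "\<forall>\<^sub>F t in nhds 0. (h 0 - m) - B / 2 * (h 0 - m)\<^sup>2 + \<eta> * ln (T 0)
      \<le> (h t - m) - B / 2 * (h t - m)\<^sup>2 + \<eta> * ln (T t)"
  defines "\<kappa> \<equiv> k 0 - k0" and "\<omega> \<equiv> w 0 - w0"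
  defines "gk \<equiv> 2 * \<kappa> / (\<rho> 0 * T 0)" and "gw \<equiv> 2 * \<omega> / (\<rho> 0 * T 0)"
    and "S \<equiv> 4 * (1 + 1 / T 0) / ((\<rho> 0)\<^sup>2 * T 0)"
  defines "gkk \<equiv> 2 / (\<rho> 0 * T 0) - S * \<kappa>\<^sup>2" and "gww \<equiv> 2 / (\<rho> 0 * T 0) - S * \<omega>\<^sup>2"
    and "gkw \<equiv> - S * \<kappa> * \<omega>"
  shows "(1 - B * (h 0 - m)) * h1 0 + \<eta> * (gk * k1 0 + gw * w1 0) = 0"
    and "- B * (h1 0)\<^sup>2 + (1 - B * (h 0 - m)) * h2 + \<eta> * (gkk * (k1 0)\<^sup>2 + 2 * gkw * k1 0 * w1 0
      + gww * (w1 0)\<^sup>2 + gk * k2 + gw * w2) \<ge> 0"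
proof -
  note at0 = ev[THEN eventually_nhds_x_imp_x]
  have cont: "isCont h 0" "isCont k 0" "isCont w 0"
    using at0 DERIV_isCont by blast+
  have c\<rho>: "isCont \<rho> 0" unfolding \<rho>_def using cont by (intro continuous_intros)
  have cT: "isCont T 0" unfolding T_def using c\<rho> pos by (intro continuous_intros) auto
  have "\<forall>\<^sub>F t in nhds 0. \<rho> t > 0" "\<forall>\<^sub>F t in nhds 0. T t > 0"
    using c\<rho> cT pos unfolding isCont_def tendsto_at_iff_tendsto_nhds
    by (auto elim!: order_tendstoD(1))
  note ev' = this
  define f' where "f' t = h1 t - B * (h t - m) * h1 t
    + \<eta> * ((2 * (k t - k0) * k1 t + 2 * (w t - w0) * w1 t) / (\<rho> t * T t))" for t
  have der: "\<forall>\<^sub>F t in nhds 0. ((\<lambda>t. (h t - m) - B / 2 * (h t - m)\<^sup>2 + \<eta> * ln (T t))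
      has_real_derivative f' t) (at t)"
    using ev ev'
  proof eventually_elim
    case (elim t)
    then show ?case
      unfolding T_def \<rho>_def f'_def
      by (auto intro!: derivative_eq_intros simp: field_simps)
  qed
  define N where "N = 2 * \<kappa> * k1 0 + 2 * \<omega> * w1 0"
  have d\<rho>: "(\<rho> has_real_derivative N) (at 0)"
    unfolding \<rho>_def N_def \<kappa>_def \<omega>_def using at0
    by (auto intro!: derivative_eq_intros simp: algebra_simps)
  have dT: "(T has_real_derivative N / \<rho> 0) (at 0)"
    unfolding T_def using d\<rho> pos by (auto intro!: derivative_eq_intros)
  define N' where "N' = 2 * (k1 0)\<^sup>2 + 2 * \<kappa> * k2 + 2 * (w1 0)\<^sup>2 + 2 * \<omega> * w2"
  have dN: "((\<lambda>t. 2 * (k t - k0) * k1 t + 2 * (w t - w0) * w1 t) has_real_derivative N') (at 0)"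
    unfolding N'_def \<kappa>_def \<omega>_def using at0 d
    by (auto intro!: derivative_eq_intros simp: power2_eq_square algebra_simps)
  have dh: "((\<lambda>t. h1 t - B * (h t - m) * h1 t) has_real_derivative
      (h2 - B * ((h1 0)\<^sup>2 + (h 0 - m) * h2))) (at 0)"
    using at0 d by (auto intro!: derivative_eq_intros simp: power2_eq_square algebra_simps)
  define D where "D = h2 - B * ((h1 0)\<^sup>2 + (h 0 - m) * h2) + \<eta> *
      ((N' * (\<rho> 0 * T 0) - N * (\<rho> 0 * (N / \<rho> 0) + N * T 0)) / ((\<rho> 0 * T 0) * (\<rho> 0 * T 0)))"
  have "((\<lambda>t. (2 * (k t - k0) * k1 t + 2 * (w t - w0) * w1 t) / (\<rho> t * T t)) has_real_derivative
      ((N' * (\<rho> 0 * T 0) - N * (\<rho> 0 * (N / \<rho> 0) + N * T 0)) / ((\<rho> 0 * T 0) * (\<rho> 0 * T 0)))) (at 0)"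
    using DERIV_divide[OF dN DERIV_mult'[OF d\<rho> dT]] pos
    by (simp only: N_def[symmetric] \<kappa>_def[symmetric] \<omega>_def[symmetric]) simp
  then have f'D: "(f' has_real_derivative D) (at 0)"
    unfolding f'_def D_def by (intro DERIV_add dh DERIV_cmult)
  note sd = second_derivative_nonneg[OF der f'D min]
  show "(1 - B * (h 0 - m)) * h1 0 + \<eta> * (gk * k1 0 + gw * w1 0) = 0"
    using sd(1) unfolding f'_def gk_def gw_def \<kappa>_def \<omega>_def
    by (simp add: algebra_simps add_divide_distrib diff_divide_distrib)
  have "(N' * (\<rho> 0 * T 0) - N * (\<rho> 0 * (N / \<rho> 0) + N * T 0)) / ((\<rho> 0 * T 0) * (\<rho> 0 * T 0))
    = N' / (\<rho> 0 * T 0) - N\<^sup>2 * ((1 + 1 / T 0) / ((\<rho> 0)\<^sup>2 * T 0))"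
    using pos by (simp add: field_simps power2_eq_square)
  also have "\<dots> = gkk * (k1 0)\<^sup>2 + 2 * gkw * k1 0 * w1 0 + gww * (w1 0)\<^sup>2 + gk * k2 + gw * w2"
  proof -
    \<comment> \<open>Names for the two reciprocals make the identity polynomial, within reach of
      \<open>algebra\<close>.\<close>
    define R where "R = (1 + 1 / T 0) / ((\<rho> 0)\<^sup>2 * T 0)"
    define I where "I = 1 / (\<rho> 0 * T 0)"
    have "S = 4 * R" "2 / (\<rho> 0 * T 0) = 2 * I" "gk = 2 * \<kappa> * I" "gw = 2 * \<omega> * I"
      "N' / (\<rho> 0 * T 0) = N' * I"
      by (simp_all add: S_def R_def I_def gk_def gw_def)
    then show ?thesis
      unfolding gkk_def gww_def gkw_def R_def[symmetric] N_def N'_def by algebra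
  qed
  finally show "- B * (h1 0)\<^sup>2 + (1 - B * (h 0 - m)) * h2 + \<eta> * (gkk * (k1 0)\<^sup>2
      + 2 * gkw * k1 0 * w1 0 + gww * (w1 0)\<^sup>2 + gk * k2 + gw * w2) \<ge> 0"
    using sd(2) unfolding D_def by (simp add: algebra_simps)
qed

text \<open>With \<open>r = sqrt \<rho>\<close>, the gradient of \<open>ln T\<close> in the plane
  has length \<open>2 * m\<close>, its second derivatives are at most \<open>8 * m / r\<close>, and
  \<open>m * r = 1 / T \<le> 1\<close>. A factor \<open>k\<close> costs at most
  \<open>K * r\<close>, so one factor turns a second derivative into O(m) and a second one into
  O(1). The last equation holds because \<open>T\<close> is harmonic, whence the Laplacian of
  \<open>ln T\<close> is minus its squared gradient.\<close>

lemma barrier_coefficient_bounds: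
  fixes \<tau> k0 \<rho>0 :: real
  assumes "\<rho>0 > 0" "\<tau> \<ge> 0"
  obtains C where "C \<ge> 0"
    and "\<And>k \<kappa> \<omega> \<rho> T gk gw S gkk gww gkw m. \<lbrakk>\<kappa> = k - k0; \<rho> = \<kappa>\<^sup>2 + \<omega>\<^sup>2; \<rho> \<ge> \<rho>0; T \<ge> 1;
      gk = 2 * \<kappa> / (\<rho> * T); gw = 2 * \<omega> / (\<rho> * T); S = 4 * (1 + 1 / T) / (\<rho>\<^sup>2 * T);
      gkk = 2 / (\<rho> * T) - S * \<kappa>\<^sup>2; gww = 2 / (\<rho> * T) - S * \<omega>\<^sup>2; gkw = - S * \<kappa> * \<omega>;
      m = 1 / (sqrt \<rho> * T)\<rbrakk> \<Longrightarrow>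
      m > 0 \<and> \<bar>gkk\<bar> \<le> C \<and> \<bar>gww\<bar> \<le> C \<and> 4 * \<tau>\<^sup>2 * k\<^sup>2 * gww \<le> C \<and>
      \<bar>2 * gkw + 4 * \<tau>\<^sup>2 * k * gw\<bar> \<le> C \<and> \<bar>- 4 * \<tau> * k * gkw - 2 * \<tau> * gw\<bar> \<le> C * m \<and>
      \<bar>2 * \<tau> * gk - 4 * \<tau> * k * gww\<bar> \<le> C * m \<and> gkk + gww = - 4 * m\<^sup>2"
proof -
  \<comment> \<open>Combines \<open>|k| \<le> |k0| + r\<close> with
    \<open>sqrt \<rho>0 \<le> r\<close> into \<open>|k| \<le> K * r\<close>.\<close>
  define K where "K = 1 + \<bar>k0\<bar> / sqrt \<rho>0"
  have K: "K \<ge> 1" using assms by (simp add: K_def)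
  \<comment> \<open>One summand per kind of estimate: \<open>k\<^sup>2 * gww\<close>, the bare
    second derivatives, \<open>k * gw\<close>, and the two entries that must keep the factor
    \<open>m\<close>.\<close>
  define C where "C = 32 * \<tau>\<^sup>2 * K\<^sup>2 + 16 / \<rho>0 + 8 * \<tau>\<^sup>2 * K + \<tau> * (32 * K + 4)"
  have C0: "C \<ge> 0" unfolding C_def using assms K by (intro add_nonneg_nonneg mult_nonneg_nonneg) auto
  show thesis
  proof (rule that[OF C0])
    fix k \<kappa> \<omega> \<rho> T gk gw S gkk gww gkw m
    assume \<kappa>: "\<kappa> = k - k0" and \<rho>: "\<rho> = \<kappa>\<^sup>2 + \<omega>\<^sup>2" "\<rho> \<ge> \<rho>0" and T: "T \<ge> 1"
      and gk: "gk = 2 * \<kappa> / (\<rho> * T)" and gw: "gw = 2 * \<omega> / (\<rho> * T)"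
      and S: "S = 4 * (1 + 1 / T) / (\<rho>\<^sup>2 * T)"
      and gkk: "gkk = 2 / (\<rho> * T) - S * \<kappa>\<^sup>2" and gww: "gww = 2 / (\<rho> * T) - S * \<omega>\<^sup>2"
      and gkw: "gkw = - S * \<kappa> * \<omega>" and m: "m = 1 / (sqrt \<rho> * T)"
    define r where "r = sqrt \<rho>"
    have \<rho>pos: "\<rho> > 0" using \<rho> assms by linarith
    have r0: "r > 0" using \<rho>pos by (simp add: r_def)
    have rr: "\<rho> = r\<^sup>2" using \<rho>pos by (simp add: r_def)
    have m0: "m > 0" and mr: "m * r \<le> 1" and m2: "m = 1 / (r * T)"
      using r0 T by (auto simp: m r_def[symmetric] field_simps)
    have inv: "1 / (\<rho> * T) = m / r"
      unfolding m2 rr using r0 T by (simp add: field_simps power2_eq_square)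
    have ka: "\<bar>\<kappa>\<bar> \<le> r" "\<bar>\<omega>\<bar> \<le> r"
      unfolding r_def \<rho> by (simp_all add: real_sqrt_sum_squares_ge1 real_le_rsqrt)
    have kr: "\<bar>k\<bar> \<le> K * r"
    proof -
      have "sqrt \<rho>0 \<le> r" using \<rho> by (simp add: r_def)
      then have "\<bar>k0\<bar> / sqrt \<rho>0 * sqrt \<rho>0 \<le> \<bar>k0\<bar> / sqrt \<rho>0 * r"
        using assms by (intro mult_left_mono) auto
      then have "\<bar>k0\<bar> \<le> \<bar>k0\<bar> / sqrt \<rho>0 * r" using assms by simp
      then show ?thesis using ka \<kappa> by (simp add: K_def algebra_simps)
    qed
    have S0: "S \<ge> 0" using T \<rho>pos by (simp add: S)
    have S8: "S * r\<^sup>2 \<le> 8 * (m / r)"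
    proof -
      have "S * r\<^sup>2 = 4 * (1 + 1 / T) * (m / r)"
        unfolding S inv[symmetric] rr using r0 T by (simp add: field_simps power2_eq_square)
      also have "\<dots> \<le> 8 * (m / r)"
        using T m0 r0 by (intro mult_right_mono) (auto simp: field_simps)
      finally show ?thesis .
    qed
    have quad: "\<bar>x * y\<bar> \<le> r\<^sup>2" if "\<bar>x\<bar> \<le> r" "\<bar>y\<bar> \<le> r" for x y
      unfolding abs_mult power2_eq_square by (rule mult_mono) (use that r0 in auto)
    have Sxy: "\<bar>S * (x * y)\<bar> \<le> 8 * (m / r)" if "\<bar>x\<bar> \<le> r" "\<bar>y\<bar> \<le> r" for x y
    proof -
      have "\<bar>S * (x * y)\<bar> = S * \<bar>x * y\<bar>" using S0 by (simp add: abs_mult)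
      also have "\<dots> \<le> S * r\<^sup>2" by (rule mult_left_mono[OF quad[OF that] S0])
      finally show ?thesis using S8 by simp
    qed
    have two: "2 / (\<rho> * T) = 2 * (m / r)" using inv by (metis times_divide_eq_right mult.right_neutral)
    have mr0: "m / r > 0" using m0 r0 by simp
    have bkk: "\<bar>gkk\<bar> \<le> 8 * (m / r)" "\<bar>gww\<bar> \<le> 8 * (m / r)" "\<bar>gkw\<bar> \<le> 8 * (m / r)"
    proof -
      have "S * \<kappa>\<^sup>2 \<ge> 0" "S * \<omega>\<^sup>2 \<ge> 0"
        using S0 by simp_all
      then show "\<bar>gkk\<bar> \<le> 8 * (m / r)" "\<bar>gww\<bar> \<le> 8 * (m / r)"
        using Sxy[OF ka(1) ka(1)] Sxy[OF ka(2) ka(2)] mr0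
        unfolding gkk gww two power2_eq_square by linarith+
      show "\<bar>gkw\<bar> \<le> 8 * (m / r)"
        using Sxy[OF ka(1) ka(2)] unfolding gkw by (simp add: mult.assoc)
    qed
    have bg: "\<bar>gk\<bar> \<le> 2 * m" "\<bar>gw\<bar> \<le> 2 * m"
    proof -
      have "\<bar>2 * x / (\<rho> * T)\<bar> \<le> 2 * m" if "\<bar>x\<bar> \<le> r" for x
      proof -
        have "2 * x / (\<rho> * T) = 2 * x * (m / r)" using inv by (metis times_divide_eq_right mult.right_neutral)
        then have "\<bar>2 * x / (\<rho> * T)\<bar> = 2 * (m / r) * \<bar>x\<bar>" using m0 r0 by (simp add: abs_mult)
        also have "\<dots> \<le> 2 * (m / r) * r" by (rule mult_left_mono[OF that]) (use mr0 in auto)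
        finally show ?thesis using r0 by simp
      qed
      then show "\<bar>gk\<bar> \<le> 2 * m" "\<bar>gw\<bar> \<le> 2 * m" unfolding gk gw using ka by blast+
    qed
    have mr\<rho>: "m / r \<le> 1 / \<rho>0"
    proof -
      have "m / r = 1 / (\<rho> * T)" using inv by simp
      also have "\<dots> \<le> 1 / (\<rho>0 * 1)" using \<rho> T assms by (intro divide_left_mono mult_mono) auto
      finally show ?thesis by simp
    qed
    have kg: "\<bar>k * g\<bar> \<le> 8 * K * m" if "\<bar>g\<bar> \<le> 8 * (m / r)" for g
    proof -
      have "\<bar>k * g\<bar> \<le> (K * r) * (8 * (m / r))"
        unfolding abs_mult by (rule mult_mono[OF kr that]) (use K r0 in auto)
      then show ?thesis using r0 by simp
    qed
    have kgw: "\<bar>k * gw\<bar> \<le> 2 * K"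
    proof -
      have "\<bar>k * gw\<bar> \<le> (K * r) * (2 * m)"
        unfolding abs_mult by (rule mult_mono[OF kr bg(2)]) (use K r0 in auto)
      also have "\<dots> = 2 * K * (m * r)" by simp
      also have "\<dots> \<le> 2 * K * 1" by (rule mult_left_mono[OF mr]) (use K in auto)
      finally show ?thesis by simp
    qed
    have k2g: "k\<^sup>2 * gww \<le> 8 * K\<^sup>2"
    proof -
      have "k\<^sup>2 * gww \<le> \<bar>k\<bar> * \<bar>k * gww\<bar>"
        by (metis abs_ge_self abs_mult mult.assoc power2_eq_square)
      also have "\<dots> \<le> (K * r) * (8 * K * m)"
        by (rule mult_mono[OF kr kg[OF bkk(2)]]) (use K r0 in auto)
      also have "\<dots> = 8 * K\<^sup>2 * (m * r)" by (simp add: power2_eq_square)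
      also have "\<dots> \<le> 8 * K\<^sup>2 * 1" by (rule mult_left_mono[OF mr]) (use K in auto)
      finally show ?thesis by simp
    qed
    have parts: "32 * \<tau>\<^sup>2 * K\<^sup>2 \<ge> 0" "16 / \<rho>0 \<ge> 0" "8 * \<tau>\<^sup>2 * K \<ge> 0" "\<tau> * (32 * K + 4) \<ge> 0"
      using assms K by auto
    have tt: "\<bar>\<tau> * x\<bar> \<le> \<tau> * y" if "\<bar>x\<bar> \<le> y" for x y
      using that assms by (simp add: abs_mult mult_left_mono)
    have CM: "\<tau> * ((32 * K + 4) * m) \<le> C * m"
      using mult_right_mono[of "\<tau> * (32 * K + 4)" C m] parts m0 by (simp add: C_def algebra_simps)
    show "m > 0 \<and> \<bar>gkk\<bar> \<le> C \<and> \<bar>gww\<bar> \<le> C \<and> 4 * \<tau>\<^sup>2 * k\<^sup>2 * gww \<le> C \<and>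
      \<bar>2 * gkw + 4 * \<tau>\<^sup>2 * k * gw\<bar> \<le> C \<and> \<bar>- 4 * \<tau> * k * gkw - 2 * \<tau> * gw\<bar> \<le> C * m \<and>
      \<bar>2 * \<tau> * gk - 4 * \<tau> * k * gww\<bar> \<le> C * m \<and> gkk + gww = - 4 * m\<^sup>2"
    proof (intro conjI)
      show "\<bar>gkk\<bar> \<le> C" "\<bar>gww\<bar> \<le> C"
        using bkk mr\<rho> parts unfolding C_def by linarith+
      show "4 * \<tau>\<^sup>2 * k\<^sup>2 * gww \<le> C"
      proof -
        have "4 * \<tau>\<^sup>2 * (k\<^sup>2 * gww) \<le> 4 * \<tau>\<^sup>2 * (8 * K\<^sup>2)"
          by (rule mult_left_mono[OF k2g]) simp
        then have "4 * \<tau>\<^sup>2 * k\<^sup>2 * gww \<le> 32 * \<tau>\<^sup>2 * K\<^sup>2"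
          by (simp add: mult.assoc)
        then show ?thesis
          using parts unfolding C_def by linarith
      qed
      have "\<bar>4 * \<tau>\<^sup>2 * (k * gw)\<bar> \<le> 4 * \<tau>\<^sup>2 * (2 * K)"
        using mult_left_mono[OF kgw, of "4 * \<tau>\<^sup>2"] by (simp add: abs_mult)
      then have "\<bar>4 * \<tau>\<^sup>2 * k * gw\<bar> \<le> 8 * \<tau>\<^sup>2 * K"
        by (simp add: mult.assoc)
      then show "\<bar>2 * gkw + 4 * \<tau>\<^sup>2 * k * gw\<bar> \<le> C"
        using bkk(3) mr\<rho> parts unfolding C_def by linarith
      have "\<bar>- 4 * (k * gkw) - 2 * gw\<bar> \<le> (32 * K + 4) * m"
        using kg[OF bkk(3)] bg(2) unfolding distrib_right by linarith
      from tt[OF this] CM show "\<bar>- 4 * \<tau> * k * gkw - 2 * \<tau> * gw\<bar> \<le> C * m"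
        by (simp add: algebra_simps)
      have "\<bar>2 * gk - 4 * (k * gww)\<bar> \<le> (32 * K + 4) * m"
        using kg[OF bkk(2)] bg(1) unfolding distrib_right by linarith
      from tt[OF this] CM show "\<bar>2 * \<tau> * gk - 4 * \<tau> * k * gww\<bar> \<le> C * m"
        by (simp add: algebra_simps)
      have "gkk + gww = 4 / (\<rho> * T) - S * \<rho>"
        unfolding gkk gww \<rho>(1) by (simp add: algebra_simps)
      also have "\<dots> = - 4 * m\<^sup>2"
        unfolding S m2 rr using r0 T by (simp add: field_simps power2_eq_square)
      finally show "gkk + gww = - 4 * m\<^sup>2" .
    qed (rule m0)
  qed
qed

section \<open>Coordinates adapted to a family of parallel vertical planes\<close>

definition nil_h :: "real \<Rightarrow> real \<Rightarrow> real ^ 3 \<Rightarrow> real" where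
  "nil_h a b p = a * p $ 1 + b * p $ 2"

definition nil_k :: "real \<Rightarrow> real \<Rightarrow> real ^ 3 \<Rightarrow> real" where
  "nil_k a b p = a * p $ 2 - b * p $ 1"

text \<open>In the coordinates \<open>(h, k, w)\<close> the metric is \<open>dh\<^sup>2 + dk\<^sup>2 + (dw + 2 \<tau> k dh)\<^sup>2\<close>, so that \<open>(k, w)\<close>
  are Euclidean coordinates on each vertical plane \<open>h = const\<close>.\<close>

definition nil_w :: "real \<Rightarrow> real \<Rightarrow> real \<Rightarrow> real ^ 3 \<Rightarrow> real" where
  "nil_w \<tau> a b p = p $ 3 - \<tau> * (p $ 1 * p $ 2) - \<tau> * (nil_h a b p * nil_k a b p)"

definition nil_dw :: "real \<Rightarrow> real \<Rightarrow> real \<Rightarrow> real ^ 3 \<Rightarrow> real ^ 3 \<Rightarrow> real" where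
  "nil_dw \<tau> a b p v = v $ 3 - \<tau> * (v $ 1 * p $ 2 + p $ 1 * v $ 2)
     - \<tau> * (nil_h a b v * nil_k a b p + nil_h a b p * nil_k a b v)"

definition nil_rho :: "real \<Rightarrow> real \<Rightarrow> real \<Rightarrow> real \<Rightarrow> real \<Rightarrow> real ^ 3 \<Rightarrow> real" where
  "nil_rho \<tau> a b k0 w0 p = (nil_k a b p - k0)\<^sup>2 + (nil_w \<tau> a b p - w0)\<^sup>2"

text \<open>The offset \<open>c\<close> stays free so that the inner logarithm can be made at least
  \<open>1\<close> on whatever region is considered: \<open>c = 1\<close> far out,
  \<open>c = 1 - ln \<rho>0\<close> near a touching disc.\<close>

definition nil_barrier ::
  "real \<Rightarrow> real \<Rightarrow> real \<Rightarrow> real \<Rightarrow> real \<Rightarrow> real \<Rightarrow> real \<Rightarrow> real \<Rightarrow> real ^ 3 \<Rightarrow> real" where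
  "nil_barrier \<tau> a b m k0 w0 c \<eta> p =
     (nil_h a b p - m) - (\<tau> + 1) / 2 * (nil_h a b p - m)\<^sup>2 + \<eta> * ln (c + ln (nil_rho \<tau> a b k0 w0 p))"

lemma linear_nil_h: "linear (nil_h a b)"
  by (rule linearI) (simp_all add: nil_h_def algebra_simps)

lemma linear_nil_k: "linear (nil_k a b)"
  by (rule linearI) (simp_all add: nil_k_def algebra_simps)

lemma linear_nil_dw: "linear (nil_dw \<tau> a b p)"
  by (rule linearI) (simp_all add: nil_dw_def nil_h_def nil_k_def algebra_simps)

lemma nil_metric_frame:
  assumes "a\<^sup>2 + b\<^sup>2 = 1"
  shows "nil_metric \<tau> p v w = nil_h a b v * nil_h a b w + nil_k a b v * nil_k a b w
    + nil_theta \<tau> p v * nil_theta \<tau> p w"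
proof -
  have "nil_h a b v * nil_h a b w + nil_k a b v * nil_k a b w
      = (a\<^sup>2 + b\<^sup>2) * (v $ 1 * w $ 1 + v $ 2 * w $ 2)"
    unfolding nil_h_def nil_k_def by algebra
  then show ?thesis
    using assms by (simp add: nil_metric_theta)
qed

text \<open>Rests on the rotation invariance \<open>x dy - y dx = h dk - k dh\<close>;
  \<open>nil_w\<close> is designed so that theta and \<open>dw\<close> differ by a multiple of
  \<open>dh\<close> and agree on each plane.\<close>

lemma nil_dw_theta:
  assumes "a\<^sup>2 + b\<^sup>2 = 1"
  shows "nil_dw \<tau> a b p v = nil_theta \<tau> p v - 2 * \<tau> * nil_k a b p * nil_h a b v"
proof -
  have "nil_h a b p * nil_k a b v - nil_k a b p * nil_h a b v
      = (a\<^sup>2 + b\<^sup>2) * (p $ 1 * v $ 2 - p $ 2 * v $ 1)"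
    unfolding nil_h_def nil_k_def by algebra
  then have "nil_h a b p * nil_k a b v = nil_k a b p * nil_h a b v + (p $ 1 * v $ 2 - p $ 2 * v $ 1)"
    using assms by simp
  then show ?thesis
    unfolding nil_dw_def nil_theta_def by algebra
qed

lemma nil_gamma_frame:
  "nil_h a b (nil_gamma \<tau> p v w)
     = \<tau> * (nil_theta \<tau> p v * nil_k a b w + nil_theta \<tau> p w * nil_k a b v)"
  "nil_k a b (nil_gamma \<tau> p v w)
     = - \<tau> * (nil_theta \<tau> p v * nil_h a b w + nil_theta \<tau> p w * nil_h a b v)"
  "nil_theta \<tau> p (nil_gamma \<tau> p v w) = - \<tau> * (v $ 1 * w $ 2 + v $ 2 * w $ 1)"
  unfolding nil_h_def nil_k_def nil_theta_def nil_gamma_def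
  by (simp_all add: algebra_simps power2_eq_square)

text \<open>\<open>l\<close> is the differential of the barrier and \<open>Q\<close> its second
  derivative in standard coordinates, so the left side is the Riemannian Hessian. The powers of
  \<open>k\<close> on the right arise from substituting theta minus \<open>2 \<tau> k dh\<close> for
  \<open>dw\<close>.\<close>

lemma nil_hessian_frame:
  assumes ab: "a\<^sup>2 + b\<^sup>2 = 1"
    and l: "\<And>y. l y = \<phi>1 * nil_h a b y + \<eta> * (gk * nil_k a b y + gw * nil_dw \<tau> a b p y)"
    and Q: "\<And>v v'. Q v v' = \<phi>2 * (nil_h a b v * nil_h a b v') + \<eta> * (gkk * (nil_k a b v * nil_k a b v')
      + gkw * (nil_k a b v * nil_dw \<tau> a b p v' + nil_k a b v' * nil_dw \<tau> a b p v)
      + gww * (nil_dw \<tau> a b p v * nil_dw \<tau> a b p v')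
      - gw * \<tau> * (v $ 1 * v' $ 2 + v $ 2 * v' $ 1 + nil_h a b v * nil_k a b v' + nil_h a b v' * nil_k a b v))"
    and x: "x1 = nil_h a b v" "x2 = nil_k a b v" "x3 = nil_theta \<tau> p v"
    and y: "y1 = nil_h a b v'" "y2 = nil_k a b v'" "y3 = nil_theta \<tau> p v'"
    and k: "k = nil_k a b p"
  shows "Q v v' - l (nil_gamma \<tau> p v v') =
    (\<phi>2 + \<eta> * (4 * \<tau>\<^sup>2 * k\<^sup>2 * gww)) * x1 * y1 + \<eta> * gkk * x2 * y2 + \<eta> * gww * x3 * y3
    + (\<eta> * (- 4 * \<tau> * k * gkw - 2 * \<tau> * gw) * (x1 * y2 + x2 * y1)
       + \<eta> * (2 * \<tau> * gk - 4 * \<tau> * k * gww) * (x1 * y3 + x3 * y1)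
       + (- 2 * \<tau> * \<phi>1 + \<eta> * (2 * gkw + 4 * \<tau>\<^sup>2 * k * gw)) * (x2 * y3 + x3 * y2)) / 2"
    (is "_ = ?R1 + ?R2 / 2")
proof -
  \<comment> \<open>This is the one expression not written in the frame. It occurs in the second
    derivative of \<open>nil_w\<close> and in theta of \<open>nil_gamma\<close>, and
    cancels.\<close>
  define s where "s = v $ 1 * v' $ 2 + v $ 2 * v' $ 1"
  have "2 * (Q v v' - l (nil_gamma \<tau> p v v')) = 2 * ?R1 + ?R2"
    unfolding Q l nil_dw_theta[OF ab] nil_gamma_frame x[symmetric] y[symmetric] k[symmetric]
      s_def[symmetric] by (simp add: algebra_simps power2_eq_square)
  moreover have "x = y + z / 2" if "2 * x = 2 * y + z" for x y z :: real
    using that by simp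
  ultimately show ?thesis by blast
qed

text \<open>On the parameter line in direction \<open>P\<close> the barrier has first derivative
  \<open>l V\<close> and second derivative \<open>Q V V + l Y\<close>, with velocity
  \<open>V\<close> and acceleration \<open>Y\<close>. The bracket multiplied by
  \<open>gw * \<tau>\<close> in \<open>Q\<close> is the contribution of the second derivative of
  \<open>nil_w\<close>.\<close>

lemma barrier_along_surface:
  fixes X :: "real ^ 2 \<Rightarrow> real ^ 3" and u P :: "real ^ 2"
  assumes \<Omega>: "open \<Omega>" "u \<in> \<Omega>" and X: "smooth_on \<Omega> X"
    and \<rho>: "\<rho> = nil_rho \<tau> a b k0 w0 (X u)" "\<rho> > 0" and T: "T = c + ln \<rho>" "T > 0"
    and min: "\<forall>\<^sub>F y in nhds u. nil_barrier \<tau> a b m k0 w0 c \<eta> (X u) \<le> nil_barrier \<tau> a b m k0 w0 c \<eta> (X y)"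
    and \<kappa>: "\<kappa> = nil_k a b (X u) - k0" and \<omega>: "\<omega> = nil_w \<tau> a b (X u) - w0"
    and gk: "gk = 2 * \<kappa> / (\<rho> * T)" and gw: "gw = 2 * \<omega> / (\<rho> * T)"
    and S: "S = 4 * (1 + 1 / T) / (\<rho>\<^sup>2 * T)"
    and gkk: "gkk = 2 / (\<rho> * T) - S * \<kappa>\<^sup>2" and gww: "gww = 2 / (\<rho> * T) - S * \<omega>\<^sup>2"
    and gkw: "gkw = - S * \<kappa> * \<omega>"
    and V: "V = P $ 1 *\<^sub>R partial_deriv 1 X u + P $ 2 *\<^sub>R partial_deriv 2 X u"
    and Y: "Y = (P $ 1)\<^sup>2 *\<^sub>R partial_deriv 1 (partial_deriv 1 X) u
      + (P $ 1 * P $ 2) *\<^sub>R (partial_deriv 1 (partial_deriv 2 X) u + partial_deriv 2 (partial_deriv 1 X) u)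
      + (P $ 2)\<^sup>2 *\<^sub>R partial_deriv 2 (partial_deriv 2 X) u"
    and \<phi>1: "\<phi>1 = 1 - (\<tau> + 1) * (nil_h a b (X u) - m)"
    and l: "\<And>y. l y = \<phi>1 * nil_h a b y + \<eta> * (gk * nil_k a b y + gw * nil_dw \<tau> a b (X u) y)"
    and Q: "\<And>v v'. Q v v' = - (\<tau> + 1) * (nil_h a b v * nil_h a b v') + \<eta> * (gkk * (nil_k a b v * nil_k a b v')
      + gkw * (nil_k a b v * nil_dw \<tau> a b (X u) v' + nil_k a b v' * nil_dw \<tau> a b (X u) v)
      + gww * (nil_dw \<tau> a b (X u) v * nil_dw \<tau> a b (X u) v')
      - gw * \<tau> * (v $ 1 * v' $ 2 + v $ 2 * v' $ 1 + nil_h a b v * nil_k a b v' + nil_h a b v' * nil_k a b v))"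
  shows "l V = 0" and "Q V V + l Y \<ge> 0"
proof -
  define Z where "Z t = X (u + t *\<^sub>R P)" for t
  define Vt where "Vt t = P $ 1 *\<^sub>R partial_deriv 1 X (u + t *\<^sub>R P)
    + P $ 2 *\<^sub>R partial_deriv 2 X (u + t *\<^sub>R P)" for t
  have Z0: "Z 0 = X u" and V0: "Vt 0 = V"
    by (simp_all add: Z_def Vt_def V)
  have comp: "((\<lambda>t. f t $ i) has_real_derivative f' $ i) (at t)"
    if "(f has_vector_derivative f') (at t)" for f :: "real \<Rightarrow> real ^ 3" and f' i t
    using bounded_linear.has_vector_derivative[OF bounded_linear_vec_nth that]
    by (simp add: has_real_derivative_iff_has_vector_derivative)
  have dZ: "\<forall>\<^sub>F t in nhds 0. \<forall>i. ((\<lambda>t. Z t $ i) has_real_derivative Vt t $ i) (at t)"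
    using smooth_on_along_line(1)[OF \<Omega> X, of P] unfolding Z_def Vt_def
    by eventually_elim (use comp in blast)
  have dV: "((\<lambda>t. Vt t $ i) has_real_derivative Y $ i) (at 0)" for i
    using comp[OF smooth_on_along_line(2)[OF \<Omega> X, of P]] unfolding Vt_def Y .
  define w1 where "w1 t = Vt t $ 3 - \<tau> * (Vt t $ 1 * Z t $ 2 + Z t $ 1 * Vt t $ 2)
    - \<tau> * (nil_h a b (Vt t) * nil_k a b (Z t) + nil_h a b (Z t) * nil_k a b (Vt t))" for t
  have dZ0: "((\<lambda>t. Z t $ i) has_real_derivative V $ i) (at 0)" for i
    using eventually_nhds_x_imp_x[OF dZ] V0 by auto
  have h: "\<forall>\<^sub>F t in nhds 0. ((\<lambda>t. nil_h a b (Z t)) has_real_derivative nil_h a b (Vt t)) (at t)"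
    using dZ by eventually_elim (auto simp: nil_h_def intro!: derivative_eq_intros)
  have k: "\<forall>\<^sub>F t in nhds 0. ((\<lambda>t. nil_k a b (Z t)) has_real_derivative nil_k a b (Vt t)) (at t)"
    using dZ by eventually_elim (auto simp: nil_k_def intro!: derivative_eq_intros)
  have w: "\<forall>\<^sub>F t in nhds 0. ((\<lambda>t. nil_w \<tau> a b (Z t)) has_real_derivative w1 t) (at t)"
    using dZ h k
  proof eventually_elim
    case (elim t)
    have "((\<lambda>t. Z t $ 3 - \<tau> * (Z t $ 1 * Z t $ 2) - \<tau> * (nil_h a b (Z t) * nil_k a b (Z t)))
        has_real_derivative (Vt t $ 3 - \<tau> * (Z t $ 1 * Vt t $ 2 + Vt t $ 1 * Z t $ 2)
          - \<tau> * (nil_h a b (Z t) * nil_k a b (Vt t) + nil_h a b (Vt t) * nil_k a b (Z t)))) (at t)"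
      using elim by (intro DERIV_diff DERIV_cmult DERIV_mult') auto
    then show ?case
      unfolding nil_w_def w1_def by (simp add: add.commute)
  qed
  have h1: "((\<lambda>t. nil_h a b (Vt t)) has_real_derivative nil_h a b Y) (at 0)"
    unfolding nil_h_def using dV by (auto intro!: derivative_eq_intros)
  have k1: "((\<lambda>t. nil_k a b (Vt t)) has_real_derivative nil_k a b Y) (at 0)"
    unfolding nil_k_def using dV by (auto intro!: derivative_eq_intros)
  note h0 = eventually_nhds_x_imp_x[OF h] eventually_nhds_x_imp_x[OF k]
  \<comment> \<open>The two subtracted products are the second derivative of the nonlinear
    coordinate \<open>nil_w\<close> evaluated on \<open>(V, V)\<close>.\<close>
  have w2: "(w1 has_real_derivative (nil_dw \<tau> a b (X u) Y - 2 * \<tau> * (V $ 1 * V $ 2)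
      - 2 * \<tau> * (nil_h a b V * nil_k a b V))) (at 0)"
  proof -
    have "(w1 has_real_derivative (Y $ 3
        - \<tau> * ((Vt 0 $ 1 * V $ 2 + Y $ 1 * Z 0 $ 2) + (Z 0 $ 1 * Y $ 2 + V $ 1 * Vt 0 $ 2))
        - \<tau> * ((nil_h a b (Vt 0) * nil_k a b (Vt 0) + nil_h a b Y * nil_k a b (Z 0))
          + (nil_h a b (Z 0) * nil_k a b Y + nil_h a b (Vt 0) * nil_k a b (Vt 0))))) (at 0)"
      unfolding w1_def by (intro DERIV_diff DERIV_cmult DERIV_add DERIV_mult' h1 k1 h0 dZ0 dV)
    then show ?thesis
      unfolding Z0 V0 nil_dw_def by (simp add: algebra_simps)
  qed
  have "((\<lambda>t. u + t *\<^sub>R P) \<longlongrightarrow> u + 0 *\<^sub>R P) (nhds 0)"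
    by (intro tendsto_intros filterlim_ident)
  then have "\<forall>\<^sub>F t in nhds 0. nil_barrier \<tau> a b m k0 w0 c \<eta> (Z 0) \<le> nil_barrier \<tau> a b m k0 w0 c \<eta> (Z t)"
    using min unfolding Z_def by (auto simp: filterlim_iff)
  then have min': "\<forall>\<^sub>F t in nhds 0. (nil_h a b (Z 0) - m) - (\<tau> + 1) / 2 * (nil_h a b (Z 0) - m)\<^sup>2
      + \<eta> * ln (c + ln ((nil_k a b (Z 0) - k0)\<^sup>2 + (nil_w \<tau> a b (Z 0) - w0)\<^sup>2))
    \<le> (nil_h a b (Z t) - m) - (\<tau> + 1) / 2 * (nil_h a b (Z t) - m)\<^sup>2
      + \<eta> * ln (c + ln ((nil_k a b (Z t) - k0)\<^sup>2 + (nil_w \<tau> a b (Z t) - w0)\<^sup>2))"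
    unfolding nil_barrier_def nil_rho_def .
  have \<rho>': "(nil_k a b (X u) - k0)\<^sup>2 + (nil_w \<tau> a b (X u) - w0)\<^sup>2 = \<rho>"
    unfolding \<rho> nil_rho_def ..
  have w10: "w1 0 = nil_dw \<tau> a b (X u) V"
    unfolding w1_def nil_dw_def Z0 V0 ..
  note bsd = barrier_second_derivative[OF h k w h1 k1 w2 _ _ min', unfolded w10 Z0 V0, unfolded \<rho>', folded T(1),
      OF \<rho>(2) T(2), folded \<kappa> \<omega>, folded gk gw S, folded gkk gww gkw, folded \<phi>1]
  show "l V = 0"
    using bsd(1) unfolding l .
  show "Q V V + l Y \<ge> 0"
    using bsd(2) unfolding l Q by (simp add: algebra_simps power2_eq_square)
qed

text \<open>At a critical point of the barrier on the surface only the normal part of the second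
  fundamental form enters the trace of the Hessian, and minimality removes it.\<close>

lemma barrier_no_local_min:
  fixes \<tau> k0 \<rho>0 :: real
  assumes \<tau>: "\<tau> \<ge> 0" and \<rho>0: "\<rho>0 > 0"
  obtains \<eta>0 where "\<eta>0 > 0"
    and "\<And>a b m w0 c \<eta> \<Omega> u (X :: real ^ 2 \<Rightarrow> real ^ 3).
      \<lbrakk>a\<^sup>2 + b\<^sup>2 = 1; 0 < \<eta>; \<eta> < \<eta>0; open \<Omega>; u \<in> \<Omega>; smooth_on \<Omega> X;
       inj (frechet_derivative X (at u));
       \<And>n. unit_normal (nil_metric \<tau>) X u n \<Longrightarrow> mean_curvature (nil_metric \<tau>) X u n = 0;
       0 \<le> nil_h a b (X u) - m; (\<tau> + 1) * (nil_h a b (X u) - m) \<le> 1;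
       \<rho>0 \<le> nil_rho \<tau> a b k0 w0 (X u); 1 \<le> c + ln (nil_rho \<tau> a b k0 w0 (X u));
       \<forall>\<^sub>F y in nhds u. nil_barrier \<tau> a b m k0 w0 c \<eta> (X u) \<le> nil_barrier \<tau> a b m k0 w0 c \<eta> (X y)\<rbrakk>
      \<Longrightarrow> False"
proof -
  obtain C where C0: "C \<ge> 0"
    and C: "\<And>k \<kappa> \<omega> \<rho> T gk gw S gkk gww gkw m. \<lbrakk>\<kappa> = k - k0; \<rho> = \<kappa>\<^sup>2 + \<omega>\<^sup>2; \<rho> \<ge> \<rho>0; T \<ge> 1;
      gk = 2 * \<kappa> / (\<rho> * T); gw = 2 * \<omega> / (\<rho> * T); S = 4 * (1 + 1 / T) / (\<rho>\<^sup>2 * T);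
      gkk = 2 / (\<rho> * T) - S * \<kappa>\<^sup>2; gww = 2 / (\<rho> * T) - S * \<omega>\<^sup>2; gkw = - S * \<kappa> * \<omega>;
      m = 1 / (sqrt \<rho> * T)\<rbrakk> \<Longrightarrow>
      m > 0 \<and> \<bar>gkk\<bar> \<le> C \<and> \<bar>gww\<bar> \<le> C \<and> 4 * \<tau>\<^sup>2 * k\<^sup>2 * gww \<le> C \<and>
      \<bar>2 * gkw + 4 * \<tau>\<^sup>2 * k * gw\<bar> \<le> C \<and> \<bar>- 4 * \<tau> * k * gkw - 2 * \<tau> * gw\<bar> \<le> C * m \<and>
      \<bar>2 * \<tau> * gk - 4 * \<tau> * k * gww\<bar> \<le> C * m \<and> gkk + gww = - 4 * m\<^sup>2"
    using barrier_coefficient_bounds[OF \<rho>0 \<tau>] by metis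
  \<comment> \<open>\<open>barrier_form_neg\<close> asks for
    \<open>\<eta> * (3 * C + C\<^sup>2) < 1\<close>; the extra \<open>1\<close> keeps the
    denominator positive even if \<open>C = 0\<close>. As \<open>C\<close> is already fixed, the
    threshold is uniform in the surface, the direction, \<open>m\<close>, \<open>w0\<close> and
    \<open>c\<close>.\<close>
  define \<eta>0 where "\<eta>0 = 1 / (3 * C + C\<^sup>2 + 1)"
  have D0: "3 * C + C\<^sup>2 + 1 > 0" using C0 by (simp add: add_nonneg_pos)
  show thesis
  proof (rule that)
    show "\<eta>0 > 0" using D0 by (simp add: \<eta>0_def)
    fix a b m w0 c \<eta> :: real and \<Omega> u and X :: "real ^ 2 \<Rightarrow> real ^ 3"
    assume ab: "a\<^sup>2 + b\<^sup>2 = 1" and \<eta>: "0 < \<eta>" "\<eta> < \<eta>0" and \<Omega>: "open \<Omega>" "u \<in> \<Omega>"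
      and X: "smooth_on \<Omega> X" and inj: "inj (frechet_derivative X (at u))"
      and minimal: "\<And>n. unit_normal (nil_metric \<tau>) X u n \<Longrightarrow> mean_curvature (nil_metric \<tau>) X u n = 0"
      and h: "0 \<le> nil_h a b (X u) - m" "(\<tau> + 1) * (nil_h a b (X u) - m) \<le> 1"
      and \<rho>ge: "\<rho>0 \<le> nil_rho \<tau> a b k0 w0 (X u)" and Tge: "1 \<le> c + ln (nil_rho \<tau> a b k0 w0 (X u))"
      and min: "\<forall>\<^sub>F y in nhds u. nil_barrier \<tau> a b m k0 w0 c \<eta> (X u) \<le> nil_barrier \<tau> a b m k0 w0 c \<eta> (X y)"
    let ?p = "X u"
    define k where "k = nil_k a b ?p"
    define \<kappa> where "\<kappa> = nil_k a b ?p - k0"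
    define \<omega> where "\<omega> = nil_w \<tau> a b ?p - w0"
    define \<rho> where "\<rho> = nil_rho \<tau> a b k0 w0 ?p"
    define T where "T = c + ln \<rho>"
    define gk where "gk = 2 * \<kappa> / (\<rho> * T)"
    define gw where "gw = 2 * \<omega> / (\<rho> * T)"
    define S where "S = 4 * (1 + 1 / T) / (\<rho>\<^sup>2 * T)"
    define gkk where "gkk = 2 / (\<rho> * T) - S * \<kappa>\<^sup>2"
    define gww where "gww = 2 / (\<rho> * T) - S * \<omega>\<^sup>2"
    define gkw where "gkw = - S * \<kappa> * \<omega>"
    define \<mu> where "\<mu> = 1 / (sqrt \<rho> * T)"
    have \<rho>1: "\<rho> \<ge> \<rho>0" and T1: "T \<ge> 1" using \<rho>ge Tge by (simp_all add: \<rho>_def T_def)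
    have \<rho>pos: "\<rho> > 0" and Tpos: "T > 0" using \<rho>1 T1 \<rho>0 by linarith+
    have \<rho>eq: "\<rho> = \<kappa>\<^sup>2 + \<omega>\<^sup>2" unfolding \<rho>_def nil_rho_def \<kappa>_def \<omega>_def ..
    have \<kappa>k: "\<kappa> = k - k0" unfolding \<kappa>_def k_def ..
    note bounds = C[OF \<kappa>k \<rho>eq \<rho>1 T1 gk_def gw_def S_def gkk_def gww_def gkw_def \<mu>_def]
    define \<phi>1 where "\<phi>1 = 1 - (\<tau> + 1) * (nil_h a b ?p - m)"
    have "0 \<le> (\<tau> + 1) * (nil_h a b ?p - m)" using h \<tau> by simp
    then have \<phi>1: "\<bar>\<phi>1\<bar> \<le> 1" using h unfolding \<phi>1_def by linarith
    define l where "l y = \<phi>1 * nil_h a b y + \<eta> * (gk * nil_k a b y + gw * nil_dw \<tau> a b ?p y)" for y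
    define Q where "Q v v' = - (\<tau> + 1) * (nil_h a b v * nil_h a b v') + \<eta> * (gkk * (nil_k a b v * nil_k a b v')
      + gkw * (nil_k a b v * nil_dw \<tau> a b ?p v' + nil_k a b v' * nil_dw \<tau> a b ?p v)
      + gww * (nil_dw \<tau> a b ?p v * nil_dw \<tau> a b ?p v')
      - gw * \<tau> * (v $ 1 * v' $ 2 + v $ 2 * v' $ 1 + nil_h a b v * nil_k a b v' + nil_h a b v' * nil_k a b v))"
      for v v'
    have linl: "linear l"
      unfolding l_def
      by (rule linearI) (simp_all add: linear_add[OF linear_nil_h] linear_add[OF linear_nil_k]
        linear_add[OF linear_nil_dw] linear_scale[OF linear_nil_h] linear_scale[OF linear_nil_k]
        linear_scale[OF linear_nil_dw] algebra_simps)
    define V where "V i = partial_deriv i X u" for i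
    define W where "W i j = partial_deriv i (partial_deriv j X) u" for i j
    have along: "l (P $ 1 *\<^sub>R V 1 + P $ 2 *\<^sub>R V 2) = 0"
      "Q (P $ 1 *\<^sub>R V 1 + P $ 2 *\<^sub>R V 2) (P $ 1 *\<^sub>R V 1 + P $ 2 *\<^sub>R V 2)
        + l ((P $ 1)\<^sup>2 *\<^sub>R W 1 1 + (P $ 1 * P $ 2) *\<^sub>R (W 1 2 + W 2 1) + (P $ 2)\<^sup>2 *\<^sub>R W 2 2) \<ge> 0"
      for P :: "real ^ 2"
      unfolding V_def W_def
      by (rule barrier_along_surface[OF \<Omega> X \<rho>_def \<rho>pos T_def Tpos min \<kappa>_def \<omega>_def gk_def gw_def
          S_def gkk_def gww_def gkw_def refl refl \<phi>1_def l_def Q_def])+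
    have Xd: "(X has_derivative frechet_derivative X (at u)) (at u)"
      using X \<Omega> unfolding smooth_on_def frechet_derivative_works[symmetric] by (metis Ck_on.simps(2))
    define E where "E = nil_metric \<tau> ?p (V 1) (V 1)"
    define F where "F = nil_metric \<tau> ?p (V 1) (V 2)"
    define G where "G = nil_metric \<tau> ?p (V 2) (V 2)"
    have E0: "E > 0" and D: "E * G - F\<^sup>2 > 0"
      using gram_pos[OF Xd inj, of \<tau>] unfolding E_def F_def G_def V_def by blast+
    have l12: "l (V 1) = 0" "l (V 2) = 0"
      using along(1)[of "axis 1 1"] along(1)[of "axis 2 1"] by (simp_all add: axis_def)
    have Qsym: "Q v v' = Q v' v" for v v'
      unfolding Q_def by (simp add: algebra_simps)
    have Qlin: "Q (x *\<^sub>R v + y *\<^sub>R v') z = x * Q v z + y * Q v' z" for x y v v' z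
      unfolding Q_def
      by (simp add: linear_add[OF linear_nil_h] linear_add[OF linear_nil_k]
        linear_add[OF linear_nil_dw] linear_scale[OF linear_nil_h] linear_scale[OF linear_nil_k]
        linear_scale[OF linear_nil_dw] algebra_simps)
    have Qlin': "Q z (x *\<^sub>R v + y *\<^sub>R v') = x * Q z v + y * Q z v'" for x y v v' z
      unfolding Qsym[of z] by (rule Qlin)
    \<comment> \<open>The second derivative in the parameters. It splits as \<open>H + N\<close>:
      the Riemannian Hessian on tangent vectors, plus the differential on covariant derivatives,
      whose trace vanishes by minimality because \<open>l\<close> is zero on the tangent
      plane.\<close>
    define A where "A i j = Q (V i) (V j) + l (W i j)" for i j
    have "G * A 1 1 - F * (A 1 2 + A 2 1) + E * A 2 2 \<ge> 0"
    proof (rule gram_trace_nonneg[OF E0 D])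
      fix x y :: real
      show "x\<^sup>2 * A 1 1 + x * y * (A 1 2 + A 2 1) + y\<^sup>2 * A 2 2 \<ge> 0"
        using along(2)[of "vector [x, y]"] Qsym[of "V 2" "V 1"] unfolding A_def Qlin Qlin'
        by (simp add: linear_add[OF linl] linear_scale[OF linl] algebra_simps power2_eq_square)
    qed
    moreover define N where "N i j = l (cov_deriv (nil_metric \<tau>) X i j u)" for i j
    have "G * N 1 1 - F * (N 1 2 + N 2 1) + E * N 2 2 = 0"
      by (rule minimal_conormal_trace[where u = u and X = X and l = l and \<tau> = \<tau>])
        (use minimal D linl l12 in \<open>simp_all add: E_def F_def G_def V_def N_def\<close>)
    moreover define H where "H i j = Q (V i) (V j) - l (nil_gamma \<tau> ?p (V i) (V j))" for i j
    have "A i j = H i j + N i j" for i j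
      unfolding A_def H_def N_def cov_deriv_nil V_def W_def by (simp add: linear_add[OF linl])
    ultimately have Hpos: "G * H 1 1 - F * (H 1 2 + H 2 1) + E * H 2 2 \<ge> 0"
      by (simp add: algebra_simps)
    define g11 where "g11 = 4 * \<tau>\<^sup>2 * k\<^sup>2 * gww"
    define g12 where "g12 = - 4 * \<tau> * k * gkw - 2 * \<tau> * gw"
    define g13 where "g13 = 2 * \<tau> * gk - 4 * \<tau> * k * gww"
    define g23 where "g23 = 2 * gkw + 4 * \<tau>\<^sup>2 * k * gw"
    define B where "B x1 x2 x3 y1 y2 y3 = (- (\<tau> + 1) + \<eta> * g11) * x1 * y1 + \<eta> * gkk * x2 * y2
      + \<eta> * gww * x3 * y3 + (\<eta> * g12 * (x1 * y2 + x2 * y1) + \<eta> * g13 * (x1 * y3 + x3 * y1)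
      + (- 2 * \<tau> * \<phi>1 + \<eta> * g23) * (x2 * y3 + x3 * y2)) / 2" for x1 x2 x3 y1 y2 y3
    have H: "H i j = B (nil_h a b (V i)) (nil_k a b (V i)) (nil_theta \<tau> ?p (V i))
        (nil_h a b (V j)) (nil_k a b (V j)) (nil_theta \<tau> ?p (V j))" for i j
      unfolding H_def B_def g11_def g12_def g13_def g23_def
      by (rule nil_hessian_frame[OF ab l_def Q_def refl refl refl refl refl refl k_def])
    define p1 where "p1 = nil_h a b (V 1)"
    define p2 where "p2 = nil_k a b (V 1)"
    define p3 where "p3 = nil_theta \<tau> ?p (V 1)"
    define q1 where "q1 = nil_h a b (V 2)"
    define q2 where "q2 = nil_k a b (V 2)"
    define q3 where "q3 = nil_theta \<tau> ?p (V 2)"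
    define c1 where "c1 = p2 * q3 - p3 * q2"
    define c2 where "c2 = p3 * q1 - p1 * q3"
    define c3 where "c3 = p1 * q2 - p2 * q1"
    note pq = p1_def[symmetric] p2_def[symmetric] p3_def[symmetric]
      q1_def[symmetric] q2_def[symmetric] q3_def[symmetric]
    have EFG: "E = p1\<^sup>2 + p2\<^sup>2 + p3\<^sup>2" "F = p1 * q1 + p2 * q2 + p3 * q3" "G = q1\<^sup>2 + q2\<^sup>2 + q3\<^sup>2"
      unfolding E_def F_def G_def nil_metric_frame[OF ab] pq by (simp_all add: power2_eq_square)
    have c: "c1\<^sup>2 + c2\<^sup>2 + c3\<^sup>2 > 0"
    proof -
      have "E * G - F\<^sup>2 = c1\<^sup>2 + c2\<^sup>2 + c3\<^sup>2"
        unfolding EFG c1_def c2_def c3_def by algebra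
      then show ?thesis using D by simp
    qed
    have "G * H 1 1 - F * (H 1 2 + H 2 1) + E * H 2 2 =
        (- (\<tau> + 1) + \<eta> * g11) * (c2\<^sup>2 + c3\<^sup>2) + \<eta> * gkk * (c1\<^sup>2 + c3\<^sup>2) + \<eta> * gww * (c1\<^sup>2 + c2\<^sup>2)
        - \<eta> * g12 * c1 * c2 - \<eta> * g13 * c1 * c3 - (- 2 * \<tau> * \<phi>1 + \<eta> * g23) * c2 * c3"
      unfolding H pq EFG by (rule frame_form_trace[OF B_def c1_def c2_def c3_def])
    also have "\<dots> < 0"
    proof (rule barrier_form_neg[OF \<tau> \<eta>(1) _ C0 _ \<phi>1 refl _ _ _ _ _ _ _ c])
      have "\<eta> * (3 * C + C\<^sup>2 + 1) < 1"
        using \<eta>(2) D0 unfolding \<eta>0_def by (simp add: pos_less_divide_eq)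
      then show "\<eta> * (3 * C + C\<^sup>2) < 1"
        using \<eta>(1) by (simp add: algebra_simps)
      show "gkk + gww \<le> - 4 * \<mu>\<^sup>2" using bounds by simp
    qed (use bounds in \<open>auto simp: g11_def g12_def g13_def g23_def\<close>)
    finally show False using Hpos by simp
  qed
qed

section \<open>Local graphs over vertical planes\<close>

text \<open>The local injectivity criterion wants the derivative close to \<open>f' a\<close> in
  operator norm; the sum of the column differences bounds that norm, so continuity of the columns
  suffices.\<close>

lemma locally_injective_C1:
  fixes f :: "real ^ 'n \<Rightarrow> 'm::euclidean_space"
  assumes \<Omega>: "open \<Omega>" "a \<in> \<Omega>"
    and der: "\<And>x. x \<in> \<Omega> \<Longrightarrow> (f has_derivative f' x) (at x)"
    and cont: "\<And>j. continuous_on \<Omega> (\<lambda>x. f' x (axis j 1))"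
    and inj: "inj (f' a)"
  obtains r where "r > 0" "ball a r \<subseteq> \<Omega>" "inj_on f (ball a r)"
proof -
  have lin: "linear (f' x)" if "x \<in> \<Omega>" for x
    using der[OF that] has_derivative_linear by blast
  obtain g' where g': "linear g'" "g' \<circ> f' a = id"
    using linear_injective_left_inverse[OF lin[OF \<Omega>(2)] inj] by blast
  have "\<exists>d>0. \<forall>x. dist a x < d \<longrightarrow> onorm (\<lambda>v. f' x v - f' a v) < e" if "e > 0" for e
  proof -
    define s where "s x = (\<Sum>j\<in>UNIV. norm (f' x (axis j 1) - f' a (axis j 1)))" for x
    have "continuous_on \<Omega> s"
      unfolding s_def by (intro continuous_intros cont)
    then have "isCont s a"
      using \<Omega> by (simp add: continuous_on_eq_continuous_at)
    have "s a = 0" by (simp add: s_def)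
    obtain d1 where d1: "d1 > 0" "\<And>x. dist x a < d1 \<Longrightarrow> s x < e"
    proof -
      have "\<forall>\<^sub>F x in nhds a. s x < e"
        using \<open>isCont s a\<close> \<open>s a = 0\<close> \<open>e > 0\<close> unfolding isCont_def tendsto_at_iff_tendsto_nhds
        by (intro order_tendstoD(2)[of s "s a"]) auto
      then show thesis
        using that unfolding eventually_nhds_metric by blast
    qed
    obtain d2 where d2: "d2 > 0" "ball a d2 \<subseteq> \<Omega>"
      using \<Omega> open_contains_ball by blast
    have "onorm (\<lambda>v. f' x v - f' a v) < e" if x: "dist a x < min d1 d2" for x
    proof -
      have "x \<in> \<Omega>" using x d2 by auto
      define L where "L v = f' x v - f' a v" for v
      have L: "linear L"
        unfolding L_def by (rule linear_compose_sub[OF lin[OF \<open>x \<in> \<Omega>\<close>] lin[OF \<Omega>(2)]])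
      have "norm (L v) \<le> s x * norm v" for v
      proof -
        have "L v = (\<Sum>j\<in>UNIV. v $ j *\<^sub>R L (axis j 1))"
        proof -
          have "v = (\<Sum>j\<in>UNIV. v $ j *\<^sub>R axis j 1)"
            using basis_expansion[of v] by (simp add: scalar_mult_eq_scaleR)
          from arg_cong[OF this, of L] show ?thesis by (simp only: linear_sum[OF L] linear_scale[OF L])
        qed
        also have "norm \<dots> \<le> (\<Sum>j\<in>UNIV. norm v * norm (L (axis j 1)))"
          by (rule sum_norm_le) (auto intro!: mult_right_mono component_le_norm_cart simp: norm_scaleR)
        also have "\<dots> = s x * norm v"
          by (simp add: s_def L_def sum_distrib_left mult.commute)
        finally show ?thesis .
      qed
      then have "onorm L \<le> s x" by (rule onorm_le)
      also have "\<dots> < e" using d1 x by (simp add: dist_commute)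
      finally show ?thesis unfolding L_def .
    qed
    then show ?thesis using d1(1) d2(1) by (intro exI[of _ "min d1 d2"]) auto
  qed
  note close = this
  have "bounded_linear g'"
    using g'(1) linear_conv_bounded_linear by blast
  from has_derivative_locally_injective[OF \<Omega>(2,1) this g'(2) der close]
  show thesis
    using that by blast
qed

lemma smooth_onD:
  fixes X :: "real ^ 2 \<Rightarrow> real ^ 3"
  assumes "open \<Omega>" "smooth_on \<Omega> X"
  shows "x \<in> \<Omega> \<Longrightarrow> (X has_derivative frechet_derivative X (at x)) (at x)"
    and "continuous_on \<Omega> (\<lambda>x. frechet_derivative X (at x) v)"
    and "continuous_on \<Omega> X"
proof -
  show "x \<in> \<Omega> \<Longrightarrow> (X has_derivative frechet_derivative X (at x)) (at x)"
    using assms unfolding smooth_on_def frechet_derivative_works[symmetric] by (metis Ck_on.simps(2))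
  show "continuous_on \<Omega> (\<lambda>x. frechet_derivative X (at x) v)"
    using assms unfolding smooth_on_def by (metis Ck_on.simps(1) Ck_on.simps(2))
  show "continuous_on \<Omega> X"
    using assms unfolding smooth_on_def by (metis Ck_on.simps(1))
qed

lemma has_derivative_nil_h:
  "(X has_derivative X') F \<Longrightarrow> ((\<lambda>y. nil_h a b (X y)) has_derivative (\<lambda>v. nil_h a b (X' v))) F"
  by (rule bounded_linear.has_derivative[of "nil_h a b"])
    (use linear_nil_h linear_conv_bounded_linear in blast)

lemma has_derivative_nil_k:
  "(X has_derivative X') F \<Longrightarrow> ((\<lambda>y. nil_k a b (X y)) has_derivative (\<lambda>v. nil_k a b (X' v))) F"
  by (rule bounded_linear.has_derivative[of "nil_k a b"])
    (use linear_nil_k linear_conv_bounded_linear in blast)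

lemma has_derivative_nil_w:
  assumes "(X has_derivative X') (at u)"
  shows "((\<lambda>y. nil_w \<tau> a b (X y)) has_derivative (\<lambda>v. nil_dw \<tau> a b (X u) (X' v))) (at u)"
proof -
  have c: "((\<lambda>y. X y $ i) has_derivative (\<lambda>v. X' v $ i)) (at u)" for i
    by (rule bounded_linear.has_derivative[OF bounded_linear_vec_nth assms])
  have h: "((\<lambda>y. nil_h a b (X y)) has_derivative (\<lambda>v. nil_h a b (X' v))) (at u)"
    using has_derivative_nil_h[OF assms] .
  have k: "((\<lambda>y. nil_k a b (X y)) has_derivative (\<lambda>v. nil_k a b (X' v))) (at u)"
    using has_derivative_nil_k[OF assms] .
  have "((\<lambda>y. X y $ 3 - \<tau> * (X y $ 1 * X y $ 2) - \<tau> * (nil_h a b (X y) * nil_k a b (X y))) has_derivative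
      (\<lambda>v. X' v $ 3 - \<tau> * (X u $ 1 * X' v $ 2 + X' v $ 1 * X u $ 2)
        - \<tau> * (nil_h a b (X u) * nil_k a b (X' v) + nil_h a b (X' v) * nil_k a b (X u)))) (at u)"
    by (intro has_derivative_diff has_derivative_mult_right has_derivative_mult c h k)
  then show ?thesis
    unfolding nil_w_def nil_dw_def by (simp add: add.commute)
qed

lemma continuous_on_nil [continuous_intros]:
  assumes "continuous_on S X"
  shows "continuous_on S (\<lambda>y. nil_h a b (X y))" "continuous_on S (\<lambda>y. nil_k a b (X y))"
    "continuous_on S (\<lambda>y. nil_w \<tau> a b (X y))"
  unfolding nil_w_def nil_h_def nil_k_def by (intro continuous_intros assms)+

lemma nil_frame_eq_0:
  assumes "a\<^sup>2 + b\<^sup>2 = 1" "nil_h a b v = 0" "nil_k a b v = 0" "nil_dw \<tau> a b p v = 0"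
  shows "v = 0"
proof -
  have "(a\<^sup>2 + b\<^sup>2) * v $ 1 = 0" "(a\<^sup>2 + b\<^sup>2) * v $ 2 = 0"
    using assms(2,3) unfolding nil_h_def nil_k_def by algebra+
  then have "v $ 1 = 0" "v $ 2 = 0" using assms(1) by auto
  moreover from this have "v $ 3 = 0"
    using assms(4) by (simp add: nil_dw_def nil_h_def nil_k_def)
  ultimately show ?thesis by (simp add: vec_eq_iff forall_3)
qed

text \<open>At a minimum of the height \<open>dh\<close> vanishes on the tangent plane, so
  \<open>dk\<close> and \<open>dw\<close> are jointly injective there. Local injectivity and
  invariance of domain then present the surface as a graph over an open part of the plane. The map
  \<open>g\<close> transports only topology; derivatives are always taken in the chart
  \<open>X\<close>.\<close>

lemma tangent_local_graph:
  fixes X :: "real ^ 2 \<Rightarrow> real ^ 3" and \<tau> a b :: real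
  defines "\<gamma> \<equiv> \<lambda>y. (nil_k a b (X y), nil_w \<tau> a b (X y))"
  assumes ab: "a\<^sup>2 + b\<^sup>2 = 1" and \<Omega>: "open \<Omega>" "u \<in> \<Omega>" and X: "smooth_on \<Omega> X"
    and inj: "inj (frechet_derivative X (at u))"
    and min: "\<And>y. y \<in> \<Omega> \<Longrightarrow> nil_h a b (X u) \<le> nil_h a b (X y)"
  obtains D g where "open D" "u \<in> D" "D \<subseteq> \<Omega>" "open (\<gamma> ` D)" "homeomorphism D (\<gamma> ` D) \<gamma> g"
proof -
  define X' where "X' y = frechet_derivative X (at y)" for y
  note XD = smooth_onD[OF \<Omega>(1) X, folded X'_def]
  have hX: "nil_h a b (X' u v) = 0" for v
  proof -
    have "\<forall>\<^sub>F y in at u. nil_h a b (X u) \<le> nil_h a b (X y)"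
      using eventually_at_in_open'[OF \<Omega>] min by (auto elim: eventually_mono)
    from has_derivative_local_min[OF has_derivative_nil_h[OF XD(1)[OF \<Omega>(2)]] this]
    show ?thesis by meson
  qed
  define \<gamma>' where "\<gamma>' y v = (nil_k a b (X' y v), nil_dw \<tau> a b (X y) (X' y v))" for y v
  have der: "(\<gamma> has_derivative \<gamma>' y) (at y)" if "y \<in> \<Omega>" for y
    unfolding \<gamma>_def \<gamma>'_def
    by (intro has_derivative_Pair has_derivative_nil_k has_derivative_nil_w XD(1) that)
  have lin: "linear (\<gamma>' u)" using der[OF \<Omega>(2)] has_derivative_linear by blast
  have linX: "linear (X' u)" using XD(1)[OF \<Omega>(2)] has_derivative_linear by blast
  have "v = 0" if "\<gamma>' u v = 0" for v
  proof -
    have "X' u v = 0"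
      using nil_frame_eq_0[OF ab hX] that unfolding \<gamma>'_def by (auto simp: zero_prod_def)
    then show ?thesis
      using inj linX unfolding X'_def[symmetric] by (simp add: linear_injective_0)
  qed
  then have inj': "inj (\<gamma>' u)" using lin by (simp add: linear_injective_0)
  have "continuous_on \<Omega> (\<lambda>y. \<gamma>' y (axis j 1))" for j
    unfolding \<gamma>'_def nil_dw_def by (intro continuous_intros XD)
  from locally_injective_C1[OF \<Omega> der this inj']
  obtain r where r: "r > 0" "ball u r \<subseteq> \<Omega>" "inj_on \<gamma> (ball u r)" by blast
  have c: "continuous_on (ball u r) \<gamma>"
    unfolding \<gamma>_def by (intro continuous_intros continuous_on_subset[OF XD(3) r(2)])
  obtain g where g: "homeomorphism (ball u r) (\<gamma> ` ball u r) \<gamma> g"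
    using invariance_of_domain_homeomorphism[OF open_ball c _ r(3)] by auto
  have "open (\<gamma> ` ball u r)"
    using c r(3) by (intro invariance_of_domain_gen) auto
  then show thesis using that[OF _ _ r(2) _ g] r(1) by auto
qed

section \<open>Contact with a vertical plane\<close>

lemma barrier_profile_pos:
  fixes t :: real
  assumes "\<tau> \<ge> 0" "0 \<le> t" "(\<tau> + 1) * t \<le> 1"
  shows "t - (\<tau> + 1) / 2 * t\<^sup>2 \<ge> t / 2"
proof -
  have "((\<tau> + 1) * t) * t \<le> 1 * t"
    using assms by (intro mult_right_mono) auto
  moreover have "(\<tau> + 1) / 2 * t\<^sup>2 = ((\<tau> + 1) * t) * t / 2"
    by (simp add: power2_eq_square)
  ultimately show ?thesis
    by linarith
qed

text \<open>Strict convexity of the norm: a ball of half the radius, tangent from inside at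
  \<open>p\<close>, meets the larger sphere at \<open>p\<close> only.\<close>

lemma interior_tangent_ball:
  fixes q p :: "'a::euclidean_space"
  assumes "y \<in> cball (midpoint q p) (dist q p / 2)" "y \<noteq> p"
  shows "y \<in> ball q (dist q p)"
proof (rule ccontr)
  assume "y \<notin> ball q (dist q p)"
  then have 1: "norm (y - q) \<ge> dist q p" by (simp add: dist_norm norm_minus_commute)
  let ?m = "midpoint q p"
  have 2: "norm (y - ?m) \<le> dist q p / 2" using assms(1) by (simp add: dist_norm norm_minus_commute)
  have 3: "norm (?m - q) = dist q p / 2"
    using dist_midpoint(1)[of q p] by (simp add: dist_norm norm_minus_commute)
  have "norm (y - q) \<le> norm (y - ?m) + norm (?m - q)"
    using norm_triangle_ineq[of "y - ?m" "?m - q"] by simp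
  with 1 2 3 have eq: "norm (y - ?m) = dist q p / 2"
    and "norm ((y - ?m) + (?m - q)) = norm (y - ?m) + norm (?m - q)" by auto
  \<comment> \<open>Equality in the triangle inequality aligns the two vectors; being equally long
    they coincide, and \<open>y\<close> is the reflection of \<open>q\<close> in the midpoint,
    namely \<open>p\<close>.\<close>
  then have "norm (y - ?m) *\<^sub>R (?m - q) = norm (?m - q) *\<^sub>R (y - ?m)"
    by (metis norm_triangle_eq)
  then have "dist q p = 0 \<or> ?m - q = y - ?m"
    using eq 3 by auto
  moreover have "y = p" if "?m - q = y - ?m"
  proof -
    have "y = 2 *\<^sub>R ?m - q" using that by (simp add: algebra_simps scaleR_2)
    then show ?thesis by (simp add: midpoint_def)
  qed
  moreover have "y = p" if "dist q p = 0"
    using that eq by (simp add: midpoint_def)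
  ultimately show False using assms(2) by blast
qed

text \<open>Hopf's geometric reduction: a nonzero point near \<open>c0\<close> and its nearest zero
  \<open>p\<close> give a disc whose interior avoids the zeros and whose boundary contains
  \<open>p\<close>. \<open>touch\<close> rules this out.\<close>

lemma zero_set_open_of_barrier:
  fixes v :: "'a::euclidean_space \<Rightarrow> real"
  assumes r: "r > 0" and cont: "continuous_on (ball c0 r) v" and nonneg: "\<And>y. y \<in> ball c0 r \<Longrightarrow> v y \<ge> 0"
    and v0: "v c0 = 0"
    and touch: "\<And>q R p. \<lbrakk>R > 0; p \<in> ball c0 r; dist q p = R; v p = 0; cball p (R / 2) \<subseteq> ball c0 r;
      \<And>y. y \<in> cball q R \<Longrightarrow> y \<noteq> p \<Longrightarrow> y \<in> ball c0 r \<Longrightarrow> v y > 0\<rbrakk> \<Longrightarrow> False"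
    and y: "y \<in> ball c0 (r / 4)"
  shows "v y = 0"
proof (rule ccontr)
  assume "v y \<noteq> 0"
  \<comment> \<open>Since \<open>y\<close> is within \<open>r / 4\<close> of \<open>c0\<close>, any
    point closer to \<open>y\<close> than \<open>p\<close> is within \<open>r / 2\<close> of
    \<open>c0\<close>. The cutoff therefore hides no competing zero, and small discs about
    \<open>p\<close> stay in the large ball.\<close>
  define Z where "Z = {z \<in> cball c0 (r / 2). v z = 0}"
  have sub: "cball c0 (r / 2) \<subseteq> ball c0 r" using r by auto
  have "closed Z"
    unfolding Z_def
    using continuous_closed_preimage_constant[OF continuous_on_subset[OF cont sub] closed_cball] .
  moreover have "c0 \<in> Z" using r v0 by (simp add: Z_def)
  ultimately obtain p where p: "p \<in> Z" "\<And>z. z \<in> Z \<Longrightarrow> dist y p \<le> dist y z"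
    using distance_attains_inf[of Z y] by blast
  have yp: "y \<noteq> p" using p(1) \<open>v y \<noteq> 0\<close> by (auto simp: Z_def)
  have le: "dist y p \<le> dist y c0" using p(2) \<open>c0 \<in> Z\<close> by blast
  have dy: "dist c0 y < r / 4" using y by simp
  \<comment> \<open>The disc about \<open>y\<close> through \<open>p\<close> may contain further
    zeros on its boundary; halving it towards \<open>p\<close> leaves \<open>p\<close> as the only
    one.\<close>
  show False
  proof (rule touch[of "dist y p / 2" p "midpoint y p"])
    show "dist y p / 2 > 0" using yp by simp
    show "p \<in> ball c0 r" "v p = 0" using p(1) sub by (auto simp: Z_def)
    show "dist (midpoint y p) p = dist y p / 2" by (simp add: dist_midpoint)
    show "cball p (dist y p / 2 / 2) \<subseteq> ball c0 r"
    proof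
      fix z assume "z \<in> cball p (dist y p / 2 / 2)"
      then have "dist p z \<le> dist y p / 4" by simp
      moreover have "dist c0 p \<le> r / 2" using p(1) by (simp add: Z_def)
      moreover have "dist c0 z \<le> dist c0 p + dist p z" by (rule dist_triangle)
      ultimately have "dist c0 z < r" using le dy r dist_commute[of y c0] by linarith
      then show "z \<in> ball c0 r" by simp
    qed
    fix z assume z: "z \<in> cball (midpoint y p) (dist y p / 2)" "z \<noteq> p" "z \<in> ball c0 r"
    from interior_tangent_ball[OF z(1,2)] have lt: "dist y z < dist y p" by simp
    have "dist c0 z \<le> dist c0 y + dist y z" by (rule dist_triangle)
    then have "dist c0 z \<le> r / 2" using le dy lt dist_commute[of y c0] by linarith
    then have "v z \<noteq> 0" using p(2)[of z] lt by (auto simp: Z_def)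
    then show "v z > 0" using nonneg[OF z(3)] by simp
  qed
qed

text \<open>A strong maximum principle for the height, read as a function \<open>v\<close> of the
  plane coordinates. In these \<open>nil_rho\<close> is the squared Euclidean distance, so the level
  sets of the logarithm are true circles and fit Hopf's touching disc.\<close>

lemma tangent_zero_set_open:
  fixes X :: "real ^ 2 \<Rightarrow> real ^ 3"
  assumes \<tau>: "\<tau> \<ge> 0" and ab: "a\<^sup>2 + b\<^sup>2 = 1" and \<Omega>: "open \<Omega>" "u \<in> \<Omega>" and X: "smooth_on \<Omega> X"
    and inj: "\<And>y. y \<in> \<Omega> \<Longrightarrow> inj (frechet_derivative X (at y))"
    and minimal: "\<And>y n. y \<in> \<Omega> \<Longrightarrow> unit_normal (nil_metric \<tau>) X y n \<Longrightarrow>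
      mean_curvature (nil_metric \<tau>) X y n = 0"
    and side: "\<And>y. y \<in> \<Omega> \<Longrightarrow> m \<le> nil_h a b (X y)" and u: "nil_h a b (X u) = m"
  obtains N where "open N" "u \<in> N" "N \<subseteq> \<Omega>" "\<And>y. y \<in> N \<Longrightarrow> nil_h a b (X y) = m"
proof -
  define \<gamma> where "\<gamma> = (\<lambda>y. (nil_k a b (X y), nil_w \<tau> a b (X y)))"
  have "\<And>y. y \<in> \<Omega> \<Longrightarrow> nil_h a b (X u) \<le> nil_h a b (X y)" using side u by simp
  from tangent_local_graph[OF ab \<Omega> X inj[OF \<Omega>(2)] this, of \<tau>]
  obtain D g where D: "open D" "u \<in> D" "D \<subseteq> \<Omega>" "open (\<gamma> ` D)" and g: "homeomorphism D (\<gamma> ` D) \<gamma> g"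
    unfolding \<gamma>_def by blast
  have gD: "g y \<in> D" "\<gamma> (g y) = y" if "y \<in> \<gamma> ` D" for y
    using g that by (auto simp: homeomorphism_def)
  have g\<gamma>: "g (\<gamma> y) = y" if "y \<in> D" for y
    using g that by (auto simp: homeomorphism_def)
  have cX: "continuous_on \<Omega> X" by (rule smooth_onD(3)[OF \<Omega>(1) X])
  have cg: "continuous_on (\<gamma> ` D) g" using g by (simp add: homeomorphism_def)
  have gD': "g ` (\<gamma> ` D) \<subseteq> \<Omega>" using gD(1) D(3) by blast
  have cXg: "continuous_on (\<gamma> ` D) (\<lambda>y. X (g y))"
    using continuous_on_compose2[OF cX cg gD'] .
  define v where "v y = nil_h a b (X (g y)) - m" for y
  have cv: "continuous_on (\<gamma> ` D) v"
    unfolding v_def by (intro continuous_intros cXg)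
  have v0: "v (\<gamma> u) = 0" using g\<gamma>[OF D(2)] u by (simp add: v_def)
  have v_nonneg: "v y \<ge> 0" if "y \<in> \<gamma> ` D" for y
    using side gD(1)[OF that] D(3) by (auto simp: v_def)
  have kw: "nil_k a b (X (g y)) = fst y" "nil_w \<tau> a b (X (g y)) = snd y" if "y \<in> \<gamma> ` D" for y
    using arg_cong[OF gD(2)[OF that], of fst] arg_cong[OF gD(2)[OF that], of snd]
    by (simp_all add: \<gamma>_def)
  have rho: "nil_rho \<tau> a b (fst q) (snd q) (X (g y)) = (dist q y)\<^sup>2" if "y \<in> \<gamma> ` D" for y q
    unfolding nil_rho_def kw[OF that]
    by (cases q, cases y) (simp add: dist_Pair_Pair dist_real_def power2_commute)
  have "open {y \<in> \<gamma> ` D. v y < 1 / (\<tau> + 1)}"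
    using continuous_open_preimage[OF cv D(4) open_lessThan] by (simp add: vimage_def Int_def)
  moreover have "\<gamma> u \<in> {y \<in> \<gamma> ` D. v y < 1 / (\<tau> + 1)}" using D(2) v0 \<tau> by simp
  ultimately obtain r where r: "r > 0" "ball (\<gamma> u) r \<subseteq> {y \<in> \<gamma> ` D. v y < 1 / (\<tau> + 1)}"
    using open_contains_ball by blast
  have rD: "y \<in> \<gamma> ` D" and vlt: "(\<tau> + 1) * v y \<le> 1" if "y \<in> ball (\<gamma> u) r" for y
    using r(2) that \<tau> by (auto simp: field_simps dest!: subsetD)
  have touch: False
    if R: "R > 0" and p: "p \<in> ball (\<gamma> u) r" "dist q p = R" "v p = 0" "cball p (R / 2) \<subseteq> ball (\<gamma> u) r"
      and pos: "\<And>y. y \<in> cball q R \<Longrightarrow> y \<noteq> p \<Longrightarrow> y \<in> ball (\<gamma> u) r \<Longrightarrow> v y > 0" for q p R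
  proof -
    \<comment> \<open>Points within \<open>R / 2\<close> of the touching point keep distance at
      least \<open>R / 2\<close> from \<open>q\<close>, the singularity of the logarithm.\<close>
    define \<rho>0 where "\<rho>0 = (R / 2)\<^sup>2"
    have \<rho>0: "\<rho>0 > 0" using R by (simp add: \<rho>0_def)
    obtain \<eta>0 where \<eta>0: "\<eta>0 > 0" and no_min: "\<And>a b m w0 c \<eta> \<Omega> u (X :: real ^ 2 \<Rightarrow> real ^ 3).
      \<lbrakk>a\<^sup>2 + b\<^sup>2 = 1; 0 < \<eta>; \<eta> < \<eta>0; open \<Omega>; u \<in> \<Omega>; smooth_on \<Omega> X;
       inj (frechet_derivative X (at u));
       \<And>n. unit_normal (nil_metric \<tau>) X u n \<Longrightarrow> mean_curvature (nil_metric \<tau>) X u n = 0;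
       0 \<le> nil_h a b (X u) - m; (\<tau> + 1) * (nil_h a b (X u) - m) \<le> 1;
       \<rho>0 \<le> nil_rho \<tau> a b (fst q) w0 (X u); 1 \<le> c + ln (nil_rho \<tau> a b (fst q) w0 (X u));
       \<forall>\<^sub>F y in nhds u. nil_barrier \<tau> a b m (fst q) w0 c \<eta> (X u)
         \<le> nil_barrier \<tau> a b m (fst q) w0 c \<eta> (X y)\<rbrakk> \<Longrightarrow> False"
      using barrier_no_local_min[OF \<tau> \<rho>0] by metis
    \<comment> \<open>Normalises \<open>T (R / 2) = 1\<close>.\<close>
    define c where "c = 1 - ln \<rho>0"
    define T where "T t = c + ln (t\<^sup>2)" for t :: real
    have T_mono: "T s < T t" if "R / 2 \<le> s" "s < t" for s t
      unfolding T_def using that R by (simp add: power_strict_mono)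
    have T1: "T t \<ge> 1" if "R / 2 \<le> t" for t
    proof -
      have "ln \<rho>0 \<le> ln (t\<^sup>2)"
        unfolding \<rho>0_def using that R by (subst ln_le_cancel_iff) (auto intro!: power_mono)
      then show ?thesis by (simp add: T_def c_def)
    qed
    define B where "B = cball p (R / 2)"
    have B: "y \<in> \<gamma> ` D" "R / 2 \<le> dist q y" "y \<in> ball (\<gamma> u) r" if "y \<in> B" for y
    proof -
      show "y \<in> ball (\<gamma> u) r" using that p(4) by (auto simp: B_def)
      then show "y \<in> \<gamma> ` D" by (rule rD)
      have "dist q p \<le> dist q y + dist y p" by (rule dist_triangle)
      then show "R / 2 \<le> dist q y" using that p(2) by (simp add: B_def dist_commute)
    qed
    \<comment> \<open>The boundary circle of \<open>B\<close> is treated in two pieces. On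
      \<open>K\<close>, which avoids \<open>p\<close>, compactness bounds \<open>v\<close> below;
      off \<open>K\<close> the distance to \<open>q\<close> exceeds \<open>R\<close>, so the
      logarithm alone exceeds its value at \<open>p\<close>. Thus the minimum over \<open>B\<close>
      is interior.\<close>
    define K where "K = sphere p (R / 2) \<inter> cball q R"
    have KB: "K \<subseteq> B" by (auto simp: K_def B_def)
    have "compact K" unfolding K_def by (simp add: compact_Int)
    have "\<exists>e>0. \<forall>y\<in>K. e \<le> v y"
    proof (cases "K = {}")
      case False
      have "continuous_on K v"
        using cv by (rule continuous_on_subset) (use KB B(1) in blast)
      from continuous_attains_inf[OF \<open>compact K\<close> False this]
      obtain y0 where y0: "y0 \<in> K" "\<And>y. y \<in> K \<Longrightarrow> v y0 \<le> v y" by blast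
      have "y0 \<noteq> p" using y0(1) R by (auto simp: K_def)
      then have "v y0 > 0"
        using pos[of y0] B(3)[of y0] y0(1) KB unfolding K_def by blast
      then show ?thesis using y0 by blast
    qed (auto intro: exI[of _ 1])
    then obtain e where e: "e > 0" "\<And>y. y \<in> K \<Longrightarrow> e \<le> v y" by blast
    have TR: "ln (T R) \<ge> 0" using T1[of R] R by simp
    \<comment> \<open>On \<open>K\<close> the profile guarantees only
      \<open>v / 2 \<ge> e / 2\<close>, which the value \<open>\<eta> * ln (T R)\<close> at
      \<open>p\<close> must not reach; \<open>1 +\<close> keeps the denominator positive.\<close>
    define \<eta> where "\<eta> = min (\<eta>0 / 2) (e / (4 * (1 + ln (T R))))"
    have \<eta>: "0 < \<eta>" "\<eta> < \<eta>0" using \<eta>0 e TR by (auto simp: \<eta>_def)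
    have \<eta>e: "\<eta> * ln (T R) < e / 2"
    proof -
      have "\<eta> * (4 * (1 + ln (T R))) \<le> e / (4 * (1 + ln (T R))) * (4 * (1 + ln (T R)))"
        by (rule mult_right_mono) (use TR in \<open>auto simp: \<eta>_def\<close>)
      then have "\<eta> * (4 * (1 + ln (T R))) \<le> e" using TR by simp
      moreover have "\<eta> * ln (T R) \<ge> 0" using \<eta> TR by simp
      ultimately show ?thesis using \<eta> e by (simp add: algebra_simps)
    qed
    define F where "F y = nil_barrier \<tau> a b m (fst q) (snd q) c \<eta> (X (g y))" for y
    have F: "F y = (v y - (\<tau> + 1) / 2 * (v y)\<^sup>2) + \<eta> * ln (T (dist q y))" if "y \<in> \<gamma> ` D" for y
      unfolding F_def nil_barrier_def rho[OF that] v_def T_def ..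
    have prof: "v y - (\<tau> + 1) / 2 * (v y)\<^sup>2 \<ge> v y / 2" if "y \<in> B" for y
      using barrier_profile_pos[OF \<tau> v_nonneg vlt] B[OF that] by blast
    have pB: "p \<in> B" using R by (simp add: B_def)
    have Fp: "F p = \<eta> * ln (T R)" using F[OF B(1)[OF pB]] p by simp
    have Fs: "F y > F p" if y: "y \<in> sphere p (R / 2)" for y
    proof -
      have yB: "y \<in> B" using y by (auto simp: B_def)
      note Fy = F[OF B(1)[OF yB]] and P = prof[OF yB]
      show ?thesis
      proof (cases "y \<in> cball q R")
        case True
        then have "e \<le> v y" using e(2) y by (auto simp: K_def)
        moreover have "\<eta> * ln (T (dist q y)) \<ge> 0" using \<eta> T1[OF B(2)[OF yB]] by simp
        ultimately show ?thesis using Fp Fy P \<eta>e by linarith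
      next
        case False
        then have "T R < T (dist q y)" using R by (intro T_mono) auto
        then have "ln (T R) < ln (T (dist q y))"
          using T1[of R] R by (subst ln_less_cancel_iff) auto
        then have "\<eta> * ln (T R) < \<eta> * ln (T (dist q y))" using \<eta> by simp
        moreover have "v y \<ge> 0" using v_nonneg B(1)[OF yB] .
        ultimately show ?thesis using Fp Fy P by linarith
      qed
    qed
    have "continuous_on B F"
    proof (rule continuous_on_eq)
      show "continuous_on B (\<lambda>y. (v y - (\<tau> + 1) / 2 * (v y)\<^sup>2) + \<eta> * ln (T (dist q y)))"
        unfolding T_def
      proof (intro continuous_intros continuous_on_subset[OF cv])
        show "B \<subseteq> \<gamma> ` D" "B \<subseteq> \<gamma> ` D" using B(1) by blast+
        show "\<forall>y\<in>B. (dist q y)\<^sup>2 \<noteq> 0" using B(2) R by force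
        show "\<forall>y\<in>B. c + ln ((dist q y)\<^sup>2) \<noteq> 0"
          using T1[OF B(2)] unfolding T_def by force
      qed
    qed (use F B(1) in auto)
    moreover have "compact B" "B \<noteq> {}" using pB by (auto simp: B_def)
    ultimately obtain y1 where y1: "y1 \<in> B" "\<And>y. y \<in> B \<Longrightarrow> F y1 \<le> F y"
      using continuous_attains_inf[of B F] by blast
    have y1b: "y1 \<in> ball p (R / 2)"
      using y1(1) y1(2)[OF pB] Fs[of y1] by (force simp: B_def)
    note y1D = B(1)[OF y1(1)]
    \<comment> \<open>The minimum is found in a disc of the plane but tested in the chart;
      invariance of domain turns a neighbourhood of \<open>y1\<close> into one of
      \<open>g y1\<close>.\<close>
    have "open (g ` ball p (R / 2))"
    proof -
      have "ball p (R / 2) \<subseteq> B" by (auto simp: B_def)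
      then have s: "ball p (R / 2) \<subseteq> \<gamma> ` D" using B(1) by blast
      show ?thesis
      proof (rule invariance_of_domain_gen)
        show "continuous_on (ball p (R / 2)) g" using cg s by (rule continuous_on_subset)
        show "inj_on g (ball p (R / 2))" using s gD(2) by (metis inj_onI subsetD)
      qed auto
    qed
    then have "\<forall>\<^sub>F z in nhds (g y1). z \<in> g ` ball p (R / 2)"
      using y1b by (intro eventually_nhds_in_open) auto
    then have ev: "\<forall>\<^sub>F z in nhds (g y1). nil_barrier \<tau> a b m (fst q) (snd q) c \<eta> (X (g y1))
        \<le> nil_barrier \<tau> a b m (fst q) (snd q) c \<eta> (X z)"
    proof eventually_elim
      case (elim z)
      then obtain y where "z = g y" "y \<in> B" unfolding B_def using ball_subset_cball by blast
      then show ?case using y1(2)[of y] by (simp add: F_def)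
    qed
    have g1: "g y1 \<in> \<Omega>" using gD(1)[OF y1D] D(3) by blast
    show False
    proof (rule no_min[OF ab \<eta> \<Omega>(1) g1 X inj[OF g1] minimal[OF g1] _ _ _ _ ev])
      show "0 \<le> nil_h a b (X (g y1)) - m" using side[OF g1] by simp
      show "(\<tau> + 1) * (nil_h a b (X (g y1)) - m) \<le> 1"
        using vlt[OF B(3)[OF y1(1)]] by (simp add: v_def)
      show "\<rho>0 \<le> nil_rho \<tau> a b (fst q) (snd q) (X (g y1))"
        unfolding rho[OF y1D] \<rho>0_def using B(2)[OF y1(1)] R by (intro power_mono) auto
      show "1 \<le> c + ln (nil_rho \<tau> a b (fst q) (snd q) (X (g y1)))"
        unfolding rho[OF y1D] using T1[OF B(2)[OF y1(1)]] by (simp add: T_def)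
    qed
  qed
  have zero: "v y = 0" if "y \<in> ball (\<gamma> u) (r / 4)" for y
  proof (rule zero_set_open_of_barrier[where v = v, OF r(1) _ _ v0 _ that])
    show "continuous_on (ball (\<gamma> u) r) v"
      using cv by (rule continuous_on_subset) (use rD in blast)
    show "v y \<ge> 0" if "y \<in> ball (\<gamma> u) r" for y
      using v_nonneg[OF rD[OF that]] .
  qed (rule touch)
  define N where "N = D \<inter> \<gamma> -` ball (\<gamma> u) (r / 4)"
  show thesis
  proof
    have "continuous_on D \<gamma>" using g by (simp add: homeomorphism_def)
    then show "open N" unfolding N_def using D(1) by (simp add: continuous_open_preimage)
    show "u \<in> N" using D(2) r(1) by (simp add: N_def)
    show "N \<subseteq> \<Omega>" using D(3) by (auto simp: N_def)
    show "nil_h a b (X y) = m" if "y \<in> N" for y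
      using zero[of "\<gamma> y"] g\<gamma>[of y] that by (simp add: N_def v_def)
  qed
qed

section \<open>Properly immersed minimal surfaces in a half-space\<close>

text \<open>The inverse of the coordinate map \<open>(h, k, w)\<close>: a rotation of the base, then
  \<open>nil_w\<close> solved for the third coordinate.\<close>

definition nil_point :: "real \<Rightarrow> real \<Rightarrow> real \<Rightarrow> real \<times> real \<times> real \<Rightarrow> real ^ 3" where
  "nil_point \<tau> a b = (\<lambda>(h, k, w). (a * h - b * k) *\<^sub>R axis 1 1 + (b * h + a * k) *\<^sub>R axis 2 1
     + (w + \<tau> * ((a * h - b * k) * (b * h + a * k)) + \<tau> * (h * k)) *\<^sub>R axis 3 1)"

lemma continuous_on_nil_point: "continuous_on S (nil_point \<tau> a b)"
  unfolding nil_point_def case_prod_unfold by (intro continuous_intros)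

lemma nil_point_nth:
  "nil_point \<tau> a b (h, k, w) $ 1 = a * h - b * k"
  "nil_point \<tau> a b (h, k, w) $ 2 = b * h + a * k"
  "nil_point \<tau> a b (h, k, w) $ 3 = w + \<tau> * ((a * h - b * k) * (b * h + a * k)) + \<tau> * (h * k)"
  by (simp_all add: nil_point_def axis_def)

lemma nil_point_coords:
  assumes ab: "a\<^sup>2 + b\<^sup>2 = 1"
  shows "nil_h a b (nil_point \<tau> a b (h, k, w)) = h" "nil_k a b (nil_point \<tau> a b (h, k, w)) = k"
    "nil_w \<tau> a b (nil_point \<tau> a b (h, k, w)) = w"
proof -
  have "a * (a * h - b * k) + b * (b * h + a * k) = (a\<^sup>2 + b\<^sup>2) * h"
    "a * (b * h + a * k) - b * (a * h - b * k) = (a\<^sup>2 + b\<^sup>2) * k" by algebra+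
  then show h: "nil_h a b (nil_point \<tau> a b (h, k, w)) = h"
    and k: "nil_k a b (nil_point \<tau> a b (h, k, w)) = k"
    unfolding nil_h_def nil_k_def nil_point_nth ab by simp_all
  show "nil_w \<tau> a b (nil_point \<tau> a b (h, k, w)) = w"
    unfolding nil_w_def h k nil_point_nth by simp
qed

lemma nil_point_surj:
  assumes ab: "a\<^sup>2 + b\<^sup>2 = 1"
  shows "nil_point \<tau> a b (nil_h a b p, nil_k a b p, nil_w \<tau> a b p) = p"
proof -
  have 1: "a * nil_h a b p - b * nil_k a b p = (a\<^sup>2 + b\<^sup>2) * p $ 1"
    and 2: "b * nil_h a b p + a * nil_k a b p = (a\<^sup>2 + b\<^sup>2) * p $ 2"
    unfolding nil_h_def nil_k_def by algebra+
  show ?thesis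
    using 1 2 by (simp add: vec_eq_iff forall_3 nil_point_nth ab) (simp add: nil_w_def)
qed

text \<open>The set is closed and lies in the image of a compact coordinate box under
  \<open>nil_point\<close>. By properness, the part of the surface in a slab with bounded
  \<open>nil_rho\<close> is then compact.\<close>

lemma compact_nil_cylinder:
  assumes "a\<^sup>2 + b\<^sup>2 = 1"
  shows "compact {p. m \<le> nil_h a b p \<and> nil_h a b p \<le> M \<and> nil_rho \<tau> a b k0 w0 p \<le> R}" (is "compact ?K")
proof -
  let ?B = "nil_point \<tau> a b ` ({m..M} \<times> {k0 - sqrt R..k0 + sqrt R} \<times> {w0 - sqrt R..w0 + sqrt R})"
  have KB: "?K \<subseteq> ?B"
  proof
    fix p assume p: "p \<in> ?K"
    have "\<bar>nil_k a b p - k0\<bar> \<le> sqrt R" "\<bar>nil_w \<tau> a b p - w0\<bar> \<le> sqrt R"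
      using p unfolding nil_rho_def
      by (auto intro!: real_le_rsqrt intro: order_trans[rotated])
    then have "(nil_h a b p, nil_k a b p, nil_w \<tau> a b p)
        \<in> {m..M} \<times> {k0 - sqrt R..k0 + sqrt R} \<times> {w0 - sqrt R..w0 + sqrt R}"
      using p by auto
    then show "p \<in> ?B"
      using nil_point_surj[OF assms, of \<tau> p] by (metis imageI)
  qed
  have "compact ?B"
    by (intro compact_continuous_image continuous_on_nil_point compact_Times) auto
  moreover have "closed ?K"
    unfolding nil_rho_def
    by (intro closed_Collect_conj closed_Collect_le continuous_intros)
  ultimately have "compact (?B \<inter> ?K)"
    by (rule compact_Int_closed)
  then show ?thesis
    unfolding Int_absorb1[OF KB] .
qed

lemma compactin_attains_inf:
  fixes g :: "'a \<Rightarrow> real"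
  assumes "compactin M D" "D \<noteq> {}" "continuous_map M euclideanreal g"
  shows "\<exists>x\<in>D. \<forall>y\<in>D. g x \<le> g y"
proof -
  have "compact (g ` D)"
    using image_compactin[OF assms(1,3)] by simp
  then show ?thesis
    using compact_attains_inf[of "g ` D"] assms(2) by simp
qed

section \<open>The height function of a proper minimal surface in a half-space\<close>

text \<open>The normal \<open>(a, b)\<close> points to the side containing the surface.
  \<open>m\<close> is just a lower bound of the height; \<open>height_attains_inf\<close> assumes in
  addition that it is approached.\<close>

locale nil_halfspace_surface =
  fixes \<tau> a b m :: real and M :: "'a topology" and A :: "'a chart set" and f :: "'a \<Rightarrow> real ^ 3"
  assumes \<tau>: "\<tau> \<ge> 0" and ab: "a\<^sup>2 + b\<^sup>2 = 1"
    and surface: "smooth_surface M A"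
    and immersion: "smooth_immersion A f"
    and proper: "proper_map M euclidean f"
    and minimal: "minimal_immersion (nil_metric \<tau>) A f"
    and side: "\<And>x. x \<in> topspace M \<Longrightarrow> m \<le> nil_h a b (f x)"
begin

lemma chart_at:
  assumes "x \<in> topspace M"
  obtains U \<phi> where "(U, \<phi>) \<in> A" "x \<in> U"
  using assms surface unfolding smooth_surface_def by auto

lemma chart:
  assumes "(U, \<phi>) \<in> A"
  defines "X \<equiv> f \<circ> inv_into U \<phi>"
  shows "openin M U" "open (\<phi> ` U)" "homeomorphic_map (subtopology M U) (top_of_set (\<phi> ` U)) \<phi>"
    and "smooth_on (\<phi> ` U) X" "\<And>u. u \<in> \<phi> ` U \<Longrightarrow> inj (frechet_derivative X (at u))"
    and "\<And>u n. u \<in> \<phi> ` U \<Longrightarrow> unit_normal (nil_metric \<tau>) X u n \<Longrightarrow> mean_curvature (nil_metric \<tau>) X u n = 0"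
    and "\<And>x. x \<in> U \<Longrightarrow> X (\<phi> x) = f x"
    and "\<And>u. u \<in> \<phi> ` U \<Longrightarrow> \<exists>x\<in>U. u = \<phi> x \<and> X u = f x"
    and "U \<subseteq> topspace M"
proof -
  show 1: "openin M U" "open (\<phi> ` U)" "homeomorphic_map (subtopology M U) (top_of_set (\<phi> ` U)) \<phi>"
    using surface assms(1) unfolding smooth_surface_def by auto
  then show U: "U \<subseteq> topspace M" by (simp add: openin_subset)
  show "smooth_on (\<phi> ` U) X" "\<And>u. u \<in> \<phi> ` U \<Longrightarrow> inj (frechet_derivative X (at u))"
    using immersion assms(1) unfolding smooth_immersion_def X_def by auto
  show "\<And>u n. u \<in> \<phi> ` U \<Longrightarrow> unit_normal (nil_metric \<tau>) X u n \<Longrightarrow> mean_curvature (nil_metric \<tau>) X u n = 0"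
    using minimal assms(1) unfolding minimal_immersion_def X_def by blast
  have inj: "inj_on \<phi> U"
    using homeomorphic_imp_injective_map[OF 1(3)] U by (simp add: Int_absorb1)
  then show X: "X (\<phi> x) = f x" if "x \<in> U" for x
    using that by (simp add: X_def)
  then show "\<And>u. u \<in> \<phi> ` U \<Longrightarrow> \<exists>x\<in>U. u = \<phi> x \<and> X u = f x" by auto
qed

lemma chart_open_image:
  assumes "(U, \<phi>) \<in> A" "openin M N"
  shows "open (\<phi> ` (U \<inter> N))"
proof -
  note c = chart[OF assms(1)]
  have "openin (subtopology M U) (U \<inter> N)"
    using assms(2) by (simp add: openin_subtopology_Int2)
  then have "openin (top_of_set (\<phi> ` U)) (\<phi> ` (U \<inter> N))"
    using homeomorphic_imp_open_map[OF c(3)] by (simp add: open_map_def)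
  then show ?thesis using c(2) by (simp add: openin_open_eq)
qed

lemma chart_open_preimage:
  assumes "(U, \<phi>) \<in> A" "open V"
  shows "openin M {x \<in> U. \<phi> x \<in> V}"
proof -
  note c = chart[OF assms(1)]
  have "continuous_map (subtopology M U) euclidean \<phi>"
    using homeomorphic_imp_continuous_map[OF c(3)] continuous_map_into_fulltopology by blast
  from openin_continuous_map_preimage[OF this, of V] assms(2)
  have "openin (subtopology M U) {x \<in> U. \<phi> x \<in> V}"
    using c(9) by (simp add: Int_absorb1)
  then show ?thesis using c(1) openin_trans_full by blast
qed

text \<open>\<open>proper_map\<close> means closed with compact fibres and does not include
  continuity, which is recovered from smoothness in the charts.\<close>

lemma continuous_map_f: "continuous_map M euclidean f"
  unfolding continuous_map_def
proof (intro conjI allI impI)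
  fix W :: "(real ^ 3) set" assume "openin euclidean W"
  then have W: "open W" by simp
  show "openin M {x \<in> topspace M. f x \<in> W}"
  proof (subst openin_subopen, clarify)
    fix x assume x: "x \<in> topspace M" "f x \<in> W"
    obtain U \<phi> where U: "(U, \<phi>) \<in> A" "x \<in> U" using chart_at[OF x(1)] .
    note c = chart[OF U(1)]
    let ?X = "f \<circ> inv_into U \<phi>"
    have "open (\<phi> ` U \<inter> ?X -` W)"
      using smooth_onD(3)[OF c(2,4)] c(2) W by (simp add: continuous_open_preimage)
    from chart_open_preimage[OF U(1) this]
    have "openin M {y \<in> U. \<phi> y \<in> \<phi> ` U \<inter> ?X -` W}" .
    moreover have "(\<phi> y \<in> \<phi> ` U \<inter> ?X -` W) = (f y \<in> W)" if "y \<in> U" for y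
      using that by (simp only: Int_iff vimage_eq c(7) imageI simp_thms)
    then have "{y \<in> U. \<phi> y \<in> \<phi> ` U \<inter> ?X -` W} = {y \<in> U. f y \<in> W}"
      by blast
    ultimately show "\<exists>T. openin M T \<and> x \<in> T \<and> T \<subseteq> {x \<in> topspace M. f x \<in> W}"
      using U(2) x(2) c(9) by (intro exI[of _ "{y \<in> U. f y \<in> W}"]) auto
  qed
qed auto

lemma continuous_map_compose_f:
  assumes "continuous_on UNIV g"
  shows "continuous_map M euclidean (\<lambda>x. g (f x))"
  using continuous_map_compose[OF continuous_map_f, of euclidean g] assms
  by (simp add: o_def)

lemma no_local_min:
  assumes "\<rho>0 > 0"
  obtains \<eta>0 where "\<eta>0 > 0" and "\<And>w0 c \<eta> x N. \<lbrakk>0 < \<eta>; \<eta> < \<eta>0; openin M N; x \<in> N;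
     (\<tau> + 1) * (nil_h a b (f x) - m) \<le> 1; \<rho>0 \<le> nil_rho \<tau> a b k0 w0 (f x);
     1 \<le> c + ln (nil_rho \<tau> a b k0 w0 (f x));
     \<And>y. y \<in> N \<Longrightarrow> nil_barrier \<tau> a b m k0 w0 c \<eta> (f x) \<le> nil_barrier \<tau> a b m k0 w0 c \<eta> (f y)\<rbrakk> \<Longrightarrow> False"
proof -
  obtain \<eta>0 where \<eta>0: "\<eta>0 > 0" and no_min: "\<And>a b m w0 c \<eta> \<Omega> u (X :: real ^ 2 \<Rightarrow> real ^ 3).
      \<lbrakk>a\<^sup>2 + b\<^sup>2 = 1; 0 < \<eta>; \<eta> < \<eta>0; open \<Omega>; u \<in> \<Omega>; smooth_on \<Omega> X;
       inj (frechet_derivative X (at u));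
       \<And>n. unit_normal (nil_metric \<tau>) X u n \<Longrightarrow> mean_curvature (nil_metric \<tau>) X u n = 0;
       0 \<le> nil_h a b (X u) - m; (\<tau> + 1) * (nil_h a b (X u) - m) \<le> 1;
       \<rho>0 \<le> nil_rho \<tau> a b k0 w0 (X u); 1 \<le> c + ln (nil_rho \<tau> a b k0 w0 (X u));
       \<forall>\<^sub>F y in nhds u. nil_barrier \<tau> a b m k0 w0 c \<eta> (X u) \<le> nil_barrier \<tau> a b m k0 w0 c \<eta> (X y)\<rbrakk>
      \<Longrightarrow> False"
    using barrier_no_local_min[OF \<tau> assms] by metis
  show thesis
  proof (rule that[OF \<eta>0])
    fix w0 c \<eta> x N
    assume \<eta>: "0 < \<eta>" "\<eta> < \<eta>0" and N: "openin M N" "x \<in> N"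
      and x: "(\<tau> + 1) * (nil_h a b (f x) - m) \<le> 1" "\<rho>0 \<le> nil_rho \<tau> a b k0 w0 (f x)"
        "1 \<le> c + ln (nil_rho \<tau> a b k0 w0 (f x))"
      and min: "\<And>y. y \<in> N \<Longrightarrow> nil_barrier \<tau> a b m k0 w0 c \<eta> (f x) \<le> nil_barrier \<tau> a b m k0 w0 c \<eta> (f y)"
    have xM: "x \<in> topspace M" using N openin_subset by blast
    obtain U \<phi> where U: "(U, \<phi>) \<in> A" "x \<in> U" using chart_at[OF xM] .
    note c = chart[OF U(1)]
    let ?X = "f \<circ> inv_into U \<phi>"
    have xU: "\<phi> x \<in> \<phi> ` U" using U(2) by blast
    have "\<forall>\<^sub>F y in nhds (\<phi> x). y \<in> \<phi> ` (U \<inter> N)"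
      using chart_open_image[OF U(1) N(1)] U(2) N(2) by (intro eventually_nhds_in_open) auto
    then have ev: "\<forall>\<^sub>F y in nhds (\<phi> x). nil_barrier \<tau> a b m k0 w0 c \<eta> (?X (\<phi> x))
        \<le> nil_barrier \<tau> a b m k0 w0 c \<eta> (?X y)"
    proof eventually_elim
      case (elim y)
      then obtain z where z: "z \<in> U" "z \<in> N" "y = \<phi> z" by blast
      show ?case unfolding z(3) c(7)[OF z(1)] c(7)[OF U(2)] by (rule min[OF z(2)])
    qed
    show False
    proof (rule no_min[OF ab \<eta> c(2) xU c(4) c(5)[OF xU] c(6)[OF xU] _ _ _ _ ev],
        unfold c(7)[OF U(2)])
      show "0 \<le> nil_h a b (f x) - m" using side[OF xM] by simp
    qed (use x in blast)+
  qed
qed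

text \<open>If \<open>m\<close> were not attained, the barrier would exceed its value at some point
  on all three walls \<open>\<rho> = 1\<close>, \<open>v = \<delta>\<close> and
  \<open>\<rho> = R\<close> of a compact region, hence have an interior minimum.\<close>

lemma height_attains_inf:
  assumes inf: "\<And>e. e > 0 \<Longrightarrow> \<exists>x\<in>topspace M. nil_h a b (f x) < m + e"
  shows "\<exists>x\<in>topspace M. nil_h a b (f x) = m"
proof (rule ccontr)
  assume none: "\<not> ?thesis"
  define v where "v x = nil_h a b (f x) - m" for x
  define \<rho> where "\<rho> x = nil_rho \<tau> a b 0 0 (f x)" for x
  \<comment> \<open>The vertex of the parabola \<open>\<phi>\<close>, up to which the profile
    increases.\<close>
  define \<delta> where "\<delta> = 1 / (\<tau> + 1)"
  have \<delta>: "\<delta> > 0" and \<delta>': "(\<tau> + 1) * \<delta> = 1" using \<tau> by (simp_all add: \<delta>_def)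
  have v_pos: "v x > 0" if "x \<in> topspace M" for x
    using side[OF that] none that by (force simp: v_def)
  have cv: "continuous_map M euclideanreal v"
    unfolding v_def by (intro continuous_map_compose_f continuous_intros)
  have c\<rho>: "continuous_map M euclideanreal \<rho>"
    unfolding \<rho>_def nil_rho_def by (intro continuous_map_compose_f continuous_intros)
  have comp: "compactin M {x \<in> topspace M. v x \<le> \<delta> \<and> \<rho> x \<le> R}" for R
  proof -
    have "compactin euclidean {p. m \<le> nil_h a b p \<and> nil_h a b p \<le> m + \<delta> \<and> nil_rho \<tau> a b 0 0 p \<le> R}"
      using compact_nil_cylinder[OF ab] by simp
    from compactin_proper_map_preimage[OF proper this] show ?thesis
      by (rule back_subst[where P = "compactin M"]) (use side in \<open>auto simp: v_def \<rho>_def\<close>)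
  qed
  \<comment> \<open>The slab part of the surface with \<open>\<rho> \<le> 1\<close> is compact, so
    an unattained infimum leaves a gap there. With \<open>e \<le> \<delta>\<close> the level
    \<open>\<phi> e\<close> is also reached on the top wall.\<close>
  obtain e where e: "0 < e" "e \<le> \<delta>" "\<And>x. x \<in> topspace M \<Longrightarrow> v x \<le> \<delta> \<Longrightarrow> \<rho> x \<le> 1 \<Longrightarrow> e \<le> v x"
  proof (cases "{x \<in> topspace M. v x \<le> \<delta> \<and> \<rho> x \<le> 1} = {}")
    case True
    then show thesis using that[of \<delta>] \<delta> by auto
  next
    case False
    obtain x0 where "x0 \<in> topspace M"
      and "\<And>x. x \<in> topspace M \<Longrightarrow> v x \<le> \<delta> \<Longrightarrow> \<rho> x \<le> 1 \<Longrightarrow> v x0 \<le> v x"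
      using compactin_attains_inf[OF comp False cv] by auto
    then show thesis using that[of "min \<delta> (v x0)"] v_pos[of x0] \<delta> by (auto simp: min_le_iff_disj)
  qed
  define \<phi> where "\<phi> t = t - (\<tau> + 1) / 2 * t\<^sup>2" for t :: real
  have \<phi>_mono: "\<phi> s < \<phi> t" if "0 \<le> s" "s < t" "t \<le> \<delta>" for s t
  proof -
    have "(\<tau> + 1) * (s + t) < (\<tau> + 1) * (2 * \<delta>)"
      by (rule mult_strict_left_mono) (use that \<tau> in auto)
    then have "0 < (t - s) * (2 - (\<tau> + 1) * (s + t))"
      using that \<delta>' by (intro mult_pos_pos) auto
    moreover have \<phi>2: "2 * \<phi> t = 2 * t - (\<tau> + 1) * t\<^sup>2" for t
      by (simp add: \<phi>_def algebra_simps)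
    have "2 * (\<phi> t - \<phi> s) = (t - s) * (2 - (\<tau> + 1) * (s + t))"
      using \<phi>2[of s] \<phi>2[of t] by algebra
    ultimately have "0 < 2 * (\<phi> t - \<phi> s)" by (simp only:)
    then show ?thesis by simp
  qed
  have \<phi>0: "\<phi> 0 = 0" by (simp add: \<phi>_def)
  have \<phi>_mono': "\<phi> s \<le> \<phi> t" if "0 \<le> s" "s \<le> t" "t \<le> \<delta>" for s t
    using \<phi>_mono[of s t] that by (cases "s = t") auto
  define \<mu> where "\<mu> = \<phi> e"
  obtain x0 where x0: "x0 \<in> topspace M" "v x0 < e"
    using inf[OF e(1)] by (force simp: v_def)
  have \<phi>x0: "\<phi> (v x0) < \<mu>"
    unfolding \<mu>_def using v_pos[OF x0(1)] x0(2) e(2) by (intro \<phi>_mono) auto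
  have \<rho>x0: "\<rho> x0 > 1" using e(2) e(3)[of x0] x0 by fastforce
  obtain \<eta>0 where \<eta>0: "\<eta>0 > 0" and no_min: "\<And>w0 c \<eta> x N. \<lbrakk>0 < \<eta>; \<eta> < \<eta>0; openin M N; x \<in> N;
     (\<tau> + 1) * (nil_h a b (f x) - m) \<le> 1; 1 \<le> nil_rho \<tau> a b 0 w0 (f x);
     1 \<le> c + ln (nil_rho \<tau> a b 0 w0 (f x));
     \<And>y. y \<in> N \<Longrightarrow> nil_barrier \<tau> a b m 0 w0 c \<eta> (f x) \<le> nil_barrier \<tau> a b m 0 w0 c \<eta> (f y)\<rbrakk> \<Longrightarrow> False"
    using no_local_min[of 1 0, OF zero_less_one] by metis
  define G where "G x = ln (1 + ln (\<rho> x))" for x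
  have G0: "G x \<ge> 0" if "\<rho> x \<ge> 1" for x using that by (simp add: G_def)
  \<comment> \<open>Keeps the barrier at \<open>x0\<close>, a point lower than \<open>e\<close>,
    below the level \<open>\<mu>\<close> once the logarithm is added.\<close>
  define \<eta> where "\<eta> = min (\<eta>0 / 2) ((\<mu> - \<phi> (v x0)) / (2 * (1 + G x0)))"
  have Gx0: "G x0 \<ge> 0" using G0 \<rho>x0 by simp
  have \<eta>: "0 < \<eta>" "\<eta> < \<eta>0" using \<eta>0 \<phi>x0 Gx0 by (auto simp: \<eta>_def)
  have Fx0: "\<phi> (v x0) + \<eta> * G x0 < \<mu>"
  proof -
    have "\<eta> * (2 * (1 + G x0)) \<le> (\<mu> - \<phi> (v x0)) / (2 * (1 + G x0)) * (2 * (1 + G x0))"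
      by (rule mult_right_mono) (use Gx0 in \<open>auto simp: \<eta>_def\<close>)
    then have "\<eta> * (2 * (1 + G x0)) \<le> \<mu> - \<phi> (v x0)" using Gx0 by simp
    moreover have "\<eta> * G x0 \<ge> 0" using \<eta> Gx0 by simp
    ultimately show ?thesis using \<eta> by (simp add: algebra_simps)
  qed
  \<comment> \<open>Inverts the double logarithm, so that \<open>\<eta> * G\<close> alone reaches
    \<open>\<mu>\<close> on the outer wall.\<close>
  define R where "R = exp (exp (\<mu> / \<eta>))"
  have big: "\<eta> * G x \<ge> \<mu>" if "\<rho> x \<ge> R" for x
  proof -
    have "ln R \<le> ln (\<rho> x)" using that by (subst ln_le_cancel_iff) (auto simp: R_def intro: less_le_trans[of 0 R])
    then have "exp (\<mu> / \<eta>) \<le> 1 + ln (\<rho> x)" by (simp add: R_def)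
    then have "ln (exp (\<mu> / \<eta>)) \<le> G x" unfolding G_def
      by (subst ln_le_cancel_iff) (auto intro: less_le_trans[of 0 "exp (\<mu> / \<eta>)"])
    then show ?thesis using \<eta> by (simp add: field_simps)
  qed
  define D where "D = {x \<in> topspace M. v x \<le> \<delta> \<and> \<rho> x \<le> R} \<inter> {x \<in> topspace M. \<rho> x \<in> {1..}}"
  have "compactin M D"
    unfolding D_def
    by (intro compact_Int_closedin comp closedin_continuous_map_preimage[OF c\<rho>]) auto
  \<comment> \<open>The \<open>max 1\<close> changes values only where \<open>\<rho> < 1\<close>,
    outside \<open>D\<close>, and makes \<open>F\<close> continuous on the whole surface.\<close>
  define F where "F x = \<phi> (v x) + \<eta> * ln (1 + ln (max 1 (\<rho> x)))" for x
  have F: "F x = \<phi> (v x) + \<eta> * G x" if "\<rho> x \<ge> 1" for x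
    using that by (simp add: F_def G_def max_def)
  have pos: "max 1 r > 0" "1 + ln (max 1 r) > 0" for r :: real
    by (simp_all add: add_pos_nonneg)
  have "continuous_on UNIV (\<lambda>p. \<phi> (nil_h a b p - m) + \<eta> * ln (1 + ln (max 1 (nil_rho \<tau> a b 0 0 p))))"
    unfolding \<phi>_def nil_rho_def
    by (intro continuous_intros ballI) (metis pos less_irrefl)+
  then have cF: "continuous_map M euclideanreal F"
    unfolding F_def v_def \<rho>_def by (rule continuous_map_compose_f)
  have \<phi>v: "\<phi> (v x) \<ge> 0" if "x \<in> topspace M" "v x \<le> \<delta>" for x
    using \<phi>_mono'[of 0 "v x"] \<phi>0 v_pos[OF that(1)] that(2) by simp
  have x0D: "x0 \<in> D"
  proof -
    have "\<rho> x0 < R"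
      using big[of x0] Fx0 \<phi>v[OF x0(1)] x0(2) e(2) by linarith
    then show ?thesis using x0 e(2) \<rho>x0 by (simp add: D_def)
  qed
  then obtain x1 where x1: "x1 \<in> D" "\<And>y. y \<in> D \<Longrightarrow> F x1 \<le> F y"
    using compactin_attains_inf[OF \<open>compactin M D\<close> _ cF] by blast
  have x1': "x1 \<in> topspace M" "v x1 \<le> \<delta>" "1 \<le> \<rho> x1" "\<rho> x1 \<le> R" using x1(1) by (auto simp: D_def)
  have Fx1: "\<phi> (v x1) + \<eta> * G x1 < \<mu>"
    using x1(2)[OF x0D] F[OF x1'(3)] F[of x0] \<rho>x0 Fx0 by simp
  have \<eta>G: "\<eta> * G x1 \<ge> 0" using \<eta> G0[OF x1'(3)] by simp
  have v1: "v x1 < \<delta>"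
  proof (rule ccontr)
    assume "\<not> v x1 < \<delta>"
    then have "\<phi> e \<le> \<phi> (v x1)" using x1'(2) e by (intro \<phi>_mono') auto
    then show False using Fx1 \<eta>G by (simp add: \<mu>_def)
  qed
  have \<rho>1: "1 < \<rho> x1"
  proof (rule ccontr)
    assume "\<not> 1 < \<rho> x1"
    then have "e \<le> v x1" using e(3)[OF x1'(1,2)] by simp
    then have "\<phi> e \<le> \<phi> (v x1)" using x1'(2) e by (intro \<phi>_mono') auto
    then show False using Fx1 \<eta>G by (simp add: \<mu>_def)
  qed
  have \<rho>2: "\<rho> x1 < R"
    using big[of x1] Fx1 \<phi>v[OF x1'(1,2)] by linarith
  define N where "N = {x \<in> topspace M. v x \<in> {..<\<delta>}} \<inter> {x \<in> topspace M. \<rho> x \<in> {1<..<R}}"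
  have N1: "openin M N"
    unfolding N_def
    by (intro openin_Int openin_continuous_map_preimage[OF cv] openin_continuous_map_preimage[OF c\<rho>]) auto
  have N2: "x1 \<in> N" using x1'(1) v1 \<rho>1 \<rho>2 by (simp add: N_def)
  have N3: "nil_barrier \<tau> a b m 0 0 1 \<eta> (f x1) \<le> nil_barrier \<tau> a b m 0 0 1 \<eta> (f y)" if "y \<in> N" for y
  proof -
    have "F x1 \<le> F y" using that by (intro x1(2)) (auto simp: N_def D_def)
    moreover have "\<rho> y \<ge> 1" using that by (simp add: N_def)
    ultimately show ?thesis
      using F[OF x1'(3)] F[of y] unfolding nil_barrier_def \<phi>_def G_def \<rho>_def v_def by simp
  qed
  show False
  proof (rule no_min[OF \<eta> N1 N2 _ _ _ N3])
    show "(\<tau> + 1) * (nil_h a b (f x1) - m) \<le> 1"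
      using mult_left_mono[of "v x1" \<delta> "\<tau> + 1"] v1 \<tau> \<delta>' by (simp add: v_def)
    show "1 \<le> nil_rho \<tau> a b 0 0 (f x1)" "1 \<le> 1 + ln (nil_rho \<tau> a b 0 0 (f x1))"
      using \<rho>1 by (simp_all add: \<rho>_def)
  qed
qed

lemma height_constant:
  assumes x0: "x0 \<in> topspace M" "nil_h a b (f x0) = m" and x: "x \<in> topspace M"
  shows "nil_h a b (f x) = m"
proof -
  define Z where "Z = {x \<in> topspace M. nil_h a b (f x) = m}"
  have "closedin M Z"
  proof -
    have "continuous_map M euclideanreal (\<lambda>x. nil_h a b (f x))"
      by (intro continuous_map_compose_f continuous_intros)
    from closedin_continuous_map_preimage[OF this, of "{m}"] show ?thesis by (simp add: Z_def)
  qed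
  moreover have "openin M Z"
  proof (subst openin_subopen, clarify)
    fix x assume xZ: "x \<in> Z"
    then have xM: "x \<in> topspace M" "nil_h a b (f x) = m" by (auto simp: Z_def)
    obtain U \<phi> where U: "(U, \<phi>) \<in> A" "x \<in> U" using chart_at[OF xM(1)] .
    note c = chart[OF U(1)]
    let ?X = "f \<circ> inv_into U \<phi>"
    have xU: "\<phi> x \<in> \<phi> ` U" using U(2) by blast
    have s: "m \<le> nil_h a b (?X y)" if "y \<in> \<phi> ` U" for y
      using c(8)[OF that] c(9) side by auto
    have "nil_h a b (?X (\<phi> x)) = m" using c(7)[OF U(2)] xM(2) by simp
    from tangent_zero_set_open[OF \<tau> ab c(2) xU c(4,5,6) s this]
    obtain N where N: "open N" "\<phi> x \<in> N" "N \<subseteq> \<phi> ` U" "\<And>y. y \<in> N \<Longrightarrow> nil_h a b (?X y) = m" by blast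
    show "\<exists>T. openin M T \<and> x \<in> T \<and> T \<subseteq> Z"
    proof (intro exI conjI)
      show "openin M {y \<in> U. \<phi> y \<in> N}" using chart_open_preimage[OF U(1) N(1)] .
      show "x \<in> {y \<in> U. \<phi> y \<in> N}" using U(2) N(2) by simp
      show "{y \<in> U. \<phi> y \<in> N} \<subseteq> Z"
        using N(4) c(7,9) by (force simp: Z_def)
    qed
  qed
  moreover have "connected_space M" using surface by (simp add: smooth_surface_def)
  ultimately have "Z = {} \<or> Z = topspace M"
    using connected_space_clopen_in by blast
  then show ?thesis using x0 x by (auto simp: Z_def)
qed

text \<open>At constant height every point is a minimum, so \<open>tangent_local_graph\<close> makes
  the projection to \<open>(k, w)\<close> open everywhere; properness makes the image closed, and
  the plane is connected.\<close>

lemma image_eq_plane: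
  assumes const: "\<And>x. x \<in> topspace M \<Longrightarrow> nil_h a b (f x) = m"
  shows "f ` topspace M = {p. nil_h a b p = m}"
proof -
  define \<gamma> where "\<gamma> p = (nil_k a b p, nil_w \<tau> a b p)" for p
  define J where "J = \<gamma> ` f ` topspace M"
  have inverse: "nil_point \<tau> a b (m, \<gamma> (f x)) = f x" if "x \<in> topspace M" for x
    using nil_point_surj[OF ab, of \<tau> "f x"] const[OF that] by (simp add: \<gamma>_def)
  \<comment> \<open>As a preimage under the continuous section
    \<open>q \<mapsto> nil_point \<tau> a b (m, q)\<close>, \<open>J\<close> inherits closedness
    from the image of \<open>f\<close>.\<close>
  have J: "J = {q. nil_point \<tau> a b (m, q) \<in> f ` topspace M}"
  proof (intro set_eqI iffI)
    fix q assume "q \<in> J"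
    then show "q \<in> {q. nil_point \<tau> a b (m, q) \<in> f ` topspace M}" using inverse by (auto simp: J_def)
  next
    fix q assume q: "q \<in> {q. nil_point \<tau> a b (m, q) \<in> f ` topspace M}"
    have "\<gamma> (nil_point \<tau> a b (m, q)) = q"
      using nil_point_coords[OF ab] by (cases q) (simp add: \<gamma>_def)
    then show "q \<in> J" using q unfolding J_def by force
  qed
  have "closed (f ` topspace M)"
    using proper_imp_closed_map[OF proper] by (simp add: closed_map_def)
  moreover have "continuous_on UNIV (\<lambda>q. nil_point \<tau> a b (m, q))"
    by (rule continuous_on_compose2[OF continuous_on_nil_point[of UNIV]]) (auto intro: continuous_intros)
  ultimately have "closed J"
    unfolding J by (metis closed_vimage vimage_def)
  moreover have "open J"
  proof (subst open_subopen, clarify)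
    fix q assume "q \<in> J"
    then obtain x where x: "x \<in> topspace M" "q = \<gamma> (f x)" by (auto simp: J_def)
    obtain U \<phi> where U: "(U, \<phi>) \<in> A" "x \<in> U" using chart_at[OF x(1)] .
    note c = chart[OF U(1)]
    let ?X = "f \<circ> inv_into U \<phi>"
    have xU: "\<phi> x \<in> \<phi> ` U" using U(2) by blast
    have Xm: "\<exists>z\<in>topspace M. ?X y = f z" if "y \<in> \<phi> ` U" for y
      using c(8)[OF that] c(9) by auto
    then have "nil_h a b (?X (\<phi> x)) \<le> nil_h a b (?X y)" if "y \<in> \<phi> ` U" for y
      using const that xU by (metis order_refl)
    from tangent_local_graph[OF ab c(2) xU c(4) c(5)[OF xU] this, of \<tau>]
    obtain D where D: "\<phi> x \<in> D" "D \<subseteq> \<phi> ` U" "open ((\<lambda>y. \<gamma> (?X y)) ` D)"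
      unfolding \<gamma>_def by blast
    show "\<exists>T. open T \<and> q \<in> T \<and> T \<subseteq> J"
    proof (intro exI conjI)
      show "q \<in> (\<lambda>y. \<gamma> (?X y)) ` D" using D(1) x(2) c(7)[OF U(2)] by (metis image_eqI)
      show "(\<lambda>y. \<gamma> (?X y)) ` D \<subseteq> J" using D(2) Xm unfolding J_def by fastforce
    qed (rule D(3))
  qed
  moreover have "topspace M \<noteq> {}" using surface unfolding smooth_surface_def by blast
  then have "J \<noteq> {}" unfolding J_def by blast
  ultimately have JU: "J = UNIV" using clopen by blast
  show ?thesis
  proof (intro set_eqI iffI)
    fix p assume "p \<in> {p. nil_h a b p = m}"
    then have "nil_point \<tau> a b (m, \<gamma> p) = p" using nil_point_surj[OF ab, of \<tau> p] by (simp add: \<gamma>_def)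
    then show "p \<in> f ` topspace M" using JU J by (metis UNIV_I mem_Collect_eq)
  qed (use const in auto)
qed

end

section \<open>Straight lines, half-planes and the conclusion\<close>

lemma straight_line_eq:
  assumes "straight_line l"
  obtains a b c where "a\<^sup>2 + b\<^sup>2 = 1" "l = {q. a * q $ 1 + b * q $ 2 = c}"
proof -
  have dim: "aff_dim l = DIM(real ^ 2) - 1"
    using assms by (simp add: straight_line_def)
  have hull: "affine hull l = l"
    using assms unfolding straight_line_def by (simp only: affine_hull_eq)
  obtain n d where n: "n \<noteq> 0" "l = {q. n \<bullet> q = d}"
    using aff_dim_eq_hyperplane[THEN iffD1, OF dim] unfolding hull by blast
  define r where "r = norm n"
  have r: "r > 0" using n(1) by (simp add: r_def)
  have "(n $ 1)\<^sup>2 + (n $ 2)\<^sup>2 = r\<^sup>2"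
    unfolding r_def power2_norm_eq_inner by (simp add: inner_vec_def sum_2 power2_eq_square)
  then have "(n $ 1 / r)\<^sup>2 + (n $ 2 / r)\<^sup>2 = 1"
    using r by (simp add: power_divide add_divide_distrib[symmetric])
  moreover have "l = {q. n $ 1 / r * q $ 1 + n $ 2 / r * q $ 2 = d / r}"
    unfolding n(2) using r by (simp add: inner_vec_def sum_2 field_simps)
  ultimately show thesis by (rule that)
qed

lemma straight_lineI:
  assumes "a\<^sup>2 + b\<^sup>2 = (1::real)"
  shows "straight_line {q. a * q $ 1 + b * q $ 2 = c}"
proof -
  define n :: "real ^ 2" where "n = vector [a, b]"
  have n: "n $ 1 = a" "n $ 2 = b" by (simp_all add: n_def)
  have eq: "{q. a * q $ 1 + b * q $ 2 = c} = {q. n \<bullet> q = c}"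
    by (simp add: inner_vec_def sum_2 n)
  have "n \<noteq> 0" using assms n by force
  then show ?thesis
    unfolding straight_line_def eq using affine_hyperplane aff_dim_hyperplane[of n c] by simp
qed

text \<open>A component of the complement is connected and misses the line, so the affine function
  defining the line has one sign on it and weakly that sign on its closure.\<close>

lemma lies_to_one_side_height:
  assumes "lies_to_one_side S P"
  obtains a b c where "a\<^sup>2 + b\<^sup>2 = 1" "P = nil_proj -` {q. a * q $ 1 + b * q $ 2 = c}"
    "\<And>p. p \<in> S \<Longrightarrow> c \<le> nil_h a b p"
proof -
  obtain l U where l: "straight_line l" "P = nil_proj -` l"
    and U: "U \<in> components (- l)" "S \<subseteq> nil_proj -` closure U"
    using assms unfolding lies_to_one_side_def by blast
  obtain a b c where ab: "a\<^sup>2 + b\<^sup>2 = 1" and leq: "l = {q. a * q $ 1 + b * q $ 2 = c}"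
    using straight_line_eq[OF l(1)] .
  define L where "L = (\<lambda>q :: real ^ 2. a * q $ 1 + b * q $ 2)"
  have cL: "continuous_on UNIV L" unfolding L_def by (intro continuous_intros)
  have Lp: "L (nil_proj p) = nil_h a b p" for p
    by (simp add: L_def nil_proj_def nil_h_def)
  have "connected U" "U \<subseteq> - l"
    using U(1) by (simp_all add: in_components_connected in_components_subset)
  let ?G = "{q. c < L q}" and ?L = "{q. L q < c}"
  have "open ?G" "open ?L"
    by (intro open_Collect_less continuous_on_const cL)+
  moreover have cover: "U \<subseteq> ?G \<union> ?L"
  proof
    fix q assume "q \<in> U"
    then have "L q \<noteq> c" using \<open>U \<subseteq> - l\<close> by (auto simp: leq L_def)
    then show "q \<in> ?G \<union> ?L" by auto
  qed
  moreover have "?G \<inter> ?L \<inter> U = {}" by auto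
  ultimately have "?G \<inter> U = {} \<or> ?L \<inter> U = {}"
    using connectedD[OF \<open>connected U\<close>] by blast
  then have "U \<subseteq> {q. c \<le> L q} \<or> U \<subseteq> {q. L q \<le> c}"
    using cover by force
  moreover have "closed {q. c \<le> L q}" "closed {q. L q \<le> c}"
    by (intro closed_Collect_le continuous_on_const cL)+
  ultimately have "closure U \<subseteq> {q. c \<le> L q} \<or> closure U \<subseteq> {q. L q \<le> c}"
    by (meson closure_minimal)
  then show thesis
  proof
    assume "closure U \<subseteq> {q. c \<le> L q}"
    then have "c \<le> nil_h a b p" if "p \<in> S" for p
      using that U(2) unfolding Lp[symmetric] by blast
    then show thesis using that[OF ab] l(2) leq by blast
  next
    \<comment> \<open>The other side is reduced to the first by reversing the normal
      \<open>(a, b)\<close>.\<close>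
    assume 1: "closure U \<subseteq> {q. L q \<le> c}"
    have "- c \<le> nil_h (- a) (- b) p" if "p \<in> S" for p
    proof -
      have "nil_h a b p \<le> c" using that U(2) 1 unfolding Lp[symmetric] by blast
      then show ?thesis by (simp add: nil_h_def)
    qed
    moreover have "l = {q. - a * q $ 1 + - b * q $ 2 = - c}" unfolding leq by auto
    ultimately show thesis using that[of "- a" "- b" "- c"] ab l(2) by simp
  qed
qed

theorem mainTheorem1:
  fixes \<tau> :: real
    and M :: "'a topology" and A :: "'a chart set" and f :: "'a \<Rightarrow> real ^ 3"
    and P :: "(real ^ 3) set"
  assumes "\<tau> \<ge> 0"
    and "smooth_surface M A"
    and "smooth_immersion A f"
    and "proper_map M euclidean f"
    and "minimal_immersion (nil_metric \<tau>) A f"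
    and "vertical_plane P"
    and "lies_to_one_side (f ` topspace M) P"
  shows "vertical_plane (f ` topspace M) \<and> parallel_vertical_planes (f ` topspace M) P"
proof -
  obtain a b c where ab: "a\<^sup>2 + b\<^sup>2 = 1" and P: "P = nil_proj -` {q. a * q $ 1 + b * q $ 2 = c}"
    and side: "\<And>p. p \<in> f ` topspace M \<Longrightarrow> c \<le> nil_h a b p"
    using lies_to_one_side_height[OF assms(7)] by blast
  define H where "H = (\<lambda>x. nil_h a b (f x)) ` topspace M"
  \<comment> \<open>\<open>P\<close> supplies only the bound \<open>c\<close>; the plane filled by
    the surface lies at the infimum \<open>m\<close>, possibly larger than \<open>c\<close>.\<close>
  define m where "m = Inf H"
  have H: "H \<noteq> {}" "bdd_below H"
    using assms(2) side unfolding H_def smooth_surface_def by (blast, intro bdd_belowI[of _ c]) auto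
  interpret nil_halfspace_surface \<tau> a b m M A f
  proof
    show "m \<le> nil_h a b (f x)" if "x \<in> topspace M" for x
      unfolding m_def using H(2) that by (intro cInf_lower) (auto simp: H_def)
  qed (use assms ab in auto)
  have "\<exists>x\<in>topspace M. nil_h a b (f x) < m + e" if e: "e > 0" for e
  proof -
    obtain y where "y \<in> H" "y < m + e"
      using cInf_lessD[OF H(1), of "m + e"] e unfolding m_def by auto
    then show ?thesis by (auto simp: H_def)
  qed
  from height_attains_inf[OF this] obtain x0 where "x0 \<in> topspace M" "nil_h a b (f x0) = m"
    by blast
  then have "f ` topspace M = {p. nil_h a b p = m}"
    using height_constant by (intro image_eq_plane) blast
  also have "\<dots> = nil_proj -` {q. a * q $ 1 + b * q $ 2 = m}"
    by (auto simp: nil_h_def nil_proj_def)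
  finally have S: "f ` topspace M = nil_proj -` {q. a * q $ 1 + b * q $ 2 = m}" .
  have "affine_parallel {q :: real ^ 2. a * q $ 1 + b * q $ 2 = m} {q. a * q $ 1 + b * q $ 2 = c}"
    unfolding affine_parallel_expl
  proof (intro exI allI)
    fix q :: "real ^ 2"
    \<comment> \<open>The translation runs along the unit normal by the difference of the two
      heights.\<close>
    have "a * (vector [(c - m) * a, (c - m) * b] + q) $ 1 + b * (vector [(c - m) * a, (c - m) * b] + q) $ 2
        = (c - m) * (a\<^sup>2 + b\<^sup>2) + (a * q $ 1 + b * q $ 2)"
      by (simp add: algebra_simps power2_eq_square)
    then show "q \<in> {q. a * q $ 1 + b * q $ 2 = m}
        \<longleftrightarrow> vector [(c - m) * a, (c - m) * b] + q \<in> {q. a * q $ 1 + b * q $ 2 = c}"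
      using ab by simp
  qed
  then show ?thesis
    using S P straight_lineI[OF ab] unfolding vertical_plane_def parallel_vertical_planes_def by blast
qed

end
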